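(* For $n\ge1$ let $P_{n}^{(\mathrm{udr},\mathrm{ipk})}(s,t)=\sum_{\pi\in\mathfrak{S}_{n}}s^{\mathrm{udr}(\pi)}t^{\mathrm{ipk}(\pi)+1}$. Then: (a) As formal power series, \begin{multline*} \frac{1}{(1-s)(1-t)}+\frac{1}{4(1-s)^{2}}\sum_{n=1}^{\infty}\frac{(1+s^{2})^{n}}{(1-s^{2})^{n-1}}\left(\frac{1+t}{1-t}\right)^{n+1}P_{n}^{(\mathrm{udr},\mathrm{ipk})}\left(\frac{2s}{1+s^{2}},\frac{4t}{(1+t)^{2}}\right)x^{n}\\ =\sum_{i,j=0}^{\infty}\left(\frac{1+x}{1-x}\right)^{2ij}\left(1+s\left(\frac{1+x}{1-x}\right)^{j}\right)s^{2i}t^{j}. \end{multline*} (b) For all $n\geq1$, \begin{multline*} \frac{1}{4(1-s)^{2}}\frac{(1+s^{2})^{n}}{(1-s^{2})^{n-1}}\left(\frac{1+t}{1-t}\right)^{n+1}P_{n}^{(\mathrm{udr},\mathrm{ipk})}\left(\frac{2s}{1+s^{2}},\frac{4t}{(1+t)^{2}}\right)\\ =\frac{1}{n!}\sum_{k=0}^n 2^{k}d(n,k)\frac{(2^{k}A_{k}(s^{2})+sB_{k}(s^{2}))A_{k}(t)}{(1-s^{2})^{k+1}(1-t)^{k+1}}. \end{multline*} (c) For all $n\ge1$, \[ P_{n}^{(\mathrm{udr},\mathrm{ipk})}(s,t) =\frac{1}{n!}\sum_{k=0}^n d(n,k)\left((1-s^{2})(1-t)\right)^{\frac{n-k}{2}}P_{k}^{\mathrm{udr}}(s)P_{k}^{\mathrm{pk}}(t).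 \]
   Context: $\mathfrak{S}_n$ is the symmetric group on $[n]$. For $\pi\in\mathfrak{S}_n$: $i\in[n-1]$ is a descent if $\pi(i)>\pi(i+1)$, $\mathrm{des}(\pi)$ the number of descents; $i$ with $2\le i\le n-1$ is a peak if $\pi(i-1)<\pi(i)>\pi(i+1)$, $\mathrm{pk}(\pi)$ the number of peaks, $\mathrm{ipk}(\pi)=\mathrm{pk}(\pi^{-1})$. A birun of $\pi$ (in one-line notation) is a maximal monotone consecutive subsequence; an up-down run is a birun or the one-element subsequence $\pi(1)$ when $\pi(1)>\pi(2)$; $\mathrm{udr}(\pi)$ is the number of up-down runs. $A_n(t)=\sum_{\pi\in\mathfrak{S}_n}t^{\mathrm{des}(\pi)+1}$, $P_n^{\mathrm{pk}}(t)=\sum_{\pi\in\mathfrak{S}_n}t^{\mathrm{pk}(\pi)+1}$, $P_n^{\mathrm{udr}}(t)=\sum_{\pi\in\mathfrak{S}_n}t^{\mathrm{udr}(\pi)}$ for $n\ge1$, all equal to $1$ for $n=0$. $B_n(t)$ is defined by $\frac{B_n(t)}{(1-t)^{n+1}}=\sum_{k\ge0}(2k+1)^nt^k$. $d(n,k)$ is the number of permutations in $\mathfrak{S}_n$ with exactly $k$ cycles, all of odd length (with $d(0,0)=1$); $d(n,k)=0$ if $n-k$ is odd. *)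

theory Defs
  imports
    "HOL-Computational_Algebra.Polynomial_FPS"
    "HOL-Combinatorics.Permutations"
    "HOL-Combinatorics.Orbits"
begin

unbundle fps_syntax

text \<open>
  The symmetric group on $\{1,\dots,n\}$ is the set of \<open>\<pi> :: nat \<Rightarrow> nat\<close> with \<open>\<pi> permutes {1..n}\<close>.
  Since such a \<open>\<pi>\<close> does not determine \<open>n\<close>, the permutation statistics take \<open>n\<close> as an argument.
\<close>

definition des :: "nat \<Rightarrow> (nat \<Rightarrow> nat) \<Rightarrow> nat" where
  "des n \<pi> = card {i \<in> {1..n - 1}. \<pi> i > \<pi> (i + 1)}"

definition pk :: "nat \<Rightarrow> (nat \<Rightarrow> nat) \<Rightarrow> nat" where
  "pk n \<pi> = card {i \<in> {2..n - 1}. \<pi> (i - 1) < \<pi> i \<and> \<pi> i > \<pi> (i + 1)}"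

definition ipk :: "nat \<Rightarrow> (nat \<Rightarrow> nat) \<Rightarrow> nat" where
  "ipk n \<pi> = pk n (inv \<pi>)"

text \<open>
  The consecutive subsequence $\pi(i), \dots, \pi(j)$ is represented by the pair \<open>(i, j)\<close> of
  its first and last position.
\<close>

definition monotone_segments :: "nat \<Rightarrow> (nat \<Rightarrow> nat) \<Rightarrow> (nat \<times> nat) set" where
  "monotone_segments n \<pi> = {(i, j). 1 \<le> i \<and> i \<le> j \<and> j \<le> n \<and>
     (strict_mono_on {i..j} \<pi> \<or> strict_antimono_on {i..j} \<pi>)}"

definition biruns :: "nat \<Rightarrow> (nat \<Rightarrow> nat) \<Rightarrow> (nat \<times> nat) set" where
  "biruns n \<pi> = {(i, j) \<in> monotone_segments n \<pi>.
     \<forall>(i', j') \<in> monotone_segments n \<pi>. {i..j} \<subseteq> {i'..j'} \<longrightarrow> (i', j') = (i, j)}"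

definition up_down_runs :: "nat \<Rightarrow> (nat \<Rightarrow> nat) \<Rightarrow> (nat \<times> nat) set" where
  "up_down_runs n \<pi> = biruns n \<pi> \<union> (if 2 \<le> n \<and> \<pi> 1 > \<pi> 2 then {(1, 1)} else {})"

definition udr :: "nat \<Rightarrow> (nat \<Rightarrow> nat) \<Rightarrow> nat" where
  "udr n \<pi> = card (up_down_runs n \<pi>)"

text \<open>The cycles, fixed points included, given by their supports.\<close>

definition cycle_supports :: "nat \<Rightarrow> (nat \<Rightarrow> nat) \<Rightarrow> nat set set" where
  "cycle_supports n \<pi> = orbit \<pi> ` {1..n}"

definition odd_cycles_perms :: "nat \<Rightarrow> nat \<Rightarrow> nat" where
  "odd_cycles_perms n k = card {\<pi>. \<pi> permutes {1..n} \<and> card (cycle_supports n \<pi>) = k \<and>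
     (\<forall>C \<in> cycle_supports n \<pi>. odd (card C))}"

text \<open>
  All polynomials below have integer coefficients. They are given by their evaluations in an
  arbitrary commutative ring, so that polynomials, power series and fractions of these may be
  substituted for the variables.
\<close>

definition eulerian_A :: "nat \<Rightarrow> 'a::comm_ring_1 \<Rightarrow> 'a" where
  "eulerian_A n t = (if n = 0 then 1 else \<Sum>\<pi> | \<pi> permutes {1..n}. t ^ (des n \<pi> + 1))"

definition P_pk :: "nat \<Rightarrow> 'a::comm_ring_1 \<Rightarrow> 'a" where
  "P_pk n t = (if n = 0 then 1 else \<Sum>\<pi> | \<pi> permutes {1..n}. t ^ (pk n \<pi> + 1))"

definition P_udr :: "nat \<Rightarrow> 'a::comm_ring_1 \<Rightarrow> 'a" where
  "P_udr n t = (if n = 0 then 1 else \<Sum>\<pi> | \<pi> permutes {1..n}. t ^ udr n \<pi>)"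

definition P_udr_ipk :: "nat \<Rightarrow> 'a::comm_ring_1 \<Rightarrow> 'a \<Rightarrow> 'a" where
  "P_udr_ipk n s t = (\<Sum>\<pi> | \<pi> permutes {1..n}. s ^ udr n \<pi> * t ^ (ipk n \<pi> + 1))"

definition eulerian_B_poly :: "nat \<Rightarrow> int poly" where
  "eulerian_B_poly n = (THE p. fps_of_poly (map_poly rat_of_int p) / (1 - fps_X) ^ (n + 1) =
     Abs_fps (\<lambda>k. (2 * of_nat k + 1) ^ n))"

definition eulerian_B :: "nat \<Rightarrow> 'a::comm_ring_1 \<Rightarrow> 'a" where
  "eulerian_B n t = poly (map_poly of_int (eulerian_B_poly n)) t"

lemma eulerian_B_series_rat_poly:
  "\<exists>q :: rat poly. (\<forall>i. coeff q i \<in> \<int>) \<and>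
     fps_of_poly q = Abs_fps (\<lambda>k. (2 * of_nat k + 1) ^ n) * (1 - fps_X) ^ (n + 1)"
proof (induction n)
  case 0
  have "fps_of_poly (1 :: rat poly) =
      Abs_fps (\<lambda>k. (2 * of_nat k + 1) ^ 0) * (1 - fps_X) ^ (0 + 1)"
    by (simp add: fps_eq_iff algebra_simps)
  moreover have "\<forall>i. coeff (1 :: rat poly) i \<in> \<int>"
    by (simp add: coeff_1)
  ultimately show ?case
    by blast
next
  case (Suc n)
  define F where "F n = Abs_fps (\<lambda>k. (2 * of_nat k + 1 :: rat) ^ n)" for n
  obtain q where q: "\<forall>i. coeff q i \<in> \<int>" "fps_of_poly q = F n * (1 - fps_X) ^ (n + 1)"
    using Suc unfolding F_def by blast
  define r where "r = [:1, of_nat (2 * n + 1):] * q + [:0, 2, -2:] * pderiv q"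
  have F_Suc: "F (Suc n) = F n + 2 * fps_X * fps_deriv (F n)"
  proof (rule fps_ext)
    fix k
    show "F (Suc n) $ k = (F n + 2 * fps_X * fps_deriv (F n)) $ k"
      by (cases k) (simp_all add: F_def mult.assoc numeral_fps_const algebra_simps)
  qed
  have X: "fps_of_poly [:1, of_nat (2 * n + 1) :: rat:] = 1 + of_nat (2 * n + 1) * fps_X"
    by (simp add: fps_of_poly_linear' fps_of_nat [symmetric] del: of_nat_Suc of_nat_add)
  have Y: "fps_of_poly [:0, 2, -2 :: rat:] = 2 * fps_X * (1 - fps_X)"
    by (simp add: fps_of_poly_pCons algebra_simps numeral_fps_const fps_const_neg [symmetric]
        del: fps_const_neg)
  have D: "fps_deriv (fps_of_poly q) = fps_deriv (F n) * (1 - fps_X) ^ (n + 1) -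
      of_nat (n + 1) * F n * (1 - fps_X) ^ n"
  proof -
    have "fps_deriv ((1 - fps_X :: rat fps) ^ (n + 1)) = - (of_nat (n + 1) * (1 - fps_X) ^ n)"
      unfolding fps_deriv_power' by (simp add: algebra_simps)
    then show ?thesis
      unfolding q(2) fps_deriv_mult by (simp add: mult_ac)
  qed
  have "fps_of_poly r = (1 + of_nat (2 * n + 1) * fps_X) * (F n * (1 - fps_X) ^ (n + 1)) +
      2 * fps_X * (1 - fps_X) * (fps_deriv (F n) * (1 - fps_X) ^ (n + 1) -
        of_nat (n + 1) * F n * (1 - fps_X) ^ n)"
    unfolding r_def fps_of_poly_add fps_of_poly_mult X Y fps_of_poly_pderiv D unfolding q(2) ..
  also have "\<dots> = F (Suc n) * (1 - fps_X) ^ (Suc n + 1)"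
    unfolding F_Suc by (simp add: algebra_simps)
  finally have "fps_of_poly r = F (Suc n) * (1 - fps_X) ^ (Suc n + 1)" .
  moreover have "coeff r i \<in> \<int>" for i
  proof -
    have "coeff [:1, of_nat (2 * n + 1) :: rat:] j \<in> \<int>" for j
      by (auto simp: coeff_pCons split: nat.split)
    moreover have "coeff [:0, 2, -2 :: rat:] j \<in> \<int>" for j
      by (auto simp: coeff_pCons split: nat.split)
    ultimately show ?thesis
      unfolding r_def coeff_add coeff_mult using q(1)
      by (intro Ints_add Ints_sum Ints_mult) (auto simp: coeff_pderiv)
  qed
  ultimately show ?case
    unfolding F_def by blast
qed

lemma eulerian_B_poly_series:
  "fps_of_poly (map_poly rat_of_int (eulerian_B_poly n)) / (1 - fps_X) ^ (n + 1) =
     Abs_fps (\<lambda>k. (2 * of_nat k + 1) ^ n)"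
proof -
  have unit: "((1 - fps_X) ^ (n + 1) :: rat fps) $ 0 \<noteq> 0"
    by (simp add: fps_nth_power_0)
  have iff: "f / (1 - fps_X) ^ (n + 1) = g \<longleftrightarrow> f = g * (1 - fps_X) ^ (n + 1)" for f g :: "rat fps"
  proof -
    have "f / (1 - fps_X) ^ (n + 1) = f * inverse ((1 - fps_X) ^ (n + 1))"
      using unit by (rule fps_divide_unit)
    moreover have "inverse ((1 - fps_X) ^ (n + 1)) * (1 - fps_X) ^ (n + 1) = (1 :: rat fps)"
      using unit by (rule inverse_mult_eq_1)
    ultimately show ?thesis
      by (auto simp: mult.assoc mult.commute [of "inverse _"])
  qed
  obtain q :: "rat poly" where q: "\<forall>i. coeff q i \<in> \<int>"
      "fps_of_poly q = Abs_fps (\<lambda>k. (2 * of_nat k + 1) ^ n) * (1 - fps_X) ^ (n + 1)"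
    using eulerian_B_series_rat_poly by blast
  obtain p where p: "q = map_poly rat_of_int p"
  proof
    show "q = map_poly rat_of_int (map_poly floor q)"
      using q(1) by (simp add: poly_eq_iff coeff_map_poly)
  qed
  show ?thesis
    unfolding eulerian_B_poly_def
  proof (rule theI)
    show "fps_of_poly (map_poly rat_of_int p) / (1 - fps_X) ^ (n + 1) =
        Abs_fps (\<lambda>k. (2 * of_nat k + 1) ^ n)"
      using q(2) p iff by blast
  next
    fix p'
    assume "fps_of_poly (map_poly rat_of_int p') / (1 - fps_X) ^ (n + 1) =
        Abs_fps (\<lambda>k. (2 * of_nat k + 1) ^ n)"
    then have "map_poly rat_of_int p' = map_poly rat_of_int p"
      using q(2) p iff by (metis fps_of_poly_eq_iff)
    then show "p' = p"
      by (simp add: poly_eq_iff coeff_map_poly)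
  qed
qed

text \<open>
  The ring $\mathbb{Q}[[s,t,x]]$ is \<open>rat fps fps fps\<close>, where \<open>x\<close> is the outermost variable and
  \<open>s\<close> the innermost one; thus \<open>F $ c $ b $ a\<close> is the coefficient of $s^a t^b x^c$.
  A family is summable if for each monomial only finitely many members have a nonzero
  coefficient there, and sums are taken coefficientwise.
\<close>

definition fps3_summable :: "('i \<Rightarrow> 'a::comm_monoid_add fps fps fps) \<Rightarrow> 'i set \<Rightarrow> bool" where
  "fps3_summable f I \<longleftrightarrow> (\<forall>a b c. finite {i \<in> I. f i $ c $ b $ a \<noteq> 0})"

definition fps3_sum :: "('i \<Rightarrow> 'a::comm_monoid_add fps fps fps) \<Rightarrow> 'i set \<Rightarrow> 'a fps fps fps" where
  "fps3_sum f I = Abs_fps (\<lambda>c. Abs_fps (\<lambda>b. Abs_fps (\<lambda>a.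
     \<Sum>i \<in> {i \<in> I. f i $ c $ b $ a \<noteq> 0}. f i $ c $ b $ a)))"

lemma fps3_summable_mult_x_power:
  fixes g :: "nat \<Rightarrow> 'a::comm_ring_1 fps fps fps"
  shows "fps3_summable (\<lambda>n. g n * fps_X ^ n) I"
  unfolding fps3_summable_def
proof (intro allI)
  fix a b c
  have "{n \<in> I. (g n * fps_X ^ n) $ c $ b $ a \<noteq> 0} \<subseteq> {..c}"
    by (auto simp: fps_X_power_mult_right_nth split: if_splits)
  then show "finite {n \<in> I. (g n * fps_X ^ n) $ c $ b $ a \<noteq> 0}"
    by (rule finite_subset) simp
qed

lemma fps3_summable_mult_s_t_power:
  fixes g :: "nat \<Rightarrow> nat \<Rightarrow> 'a::comm_ring_1 fps fps fps"
  shows "fps3_summable (\<lambda>(i, j). g i j * fps_const (fps_const fps_X) ^ (2 * i) *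
    fps_const fps_X ^ j) I"
  unfolding fps3_summable_def
proof (intro allI)
  fix a b c
  have "(g i j * fps_const (fps_const fps_X) ^ (2 * i) * fps_const fps_X ^ j) $ c $ b $ a =
      (if b < j \<or> a < 2 * i then 0 else g i j $ c $ (b - j) $ (a - 2 * i))" for i j
    by (simp add: fps_const_power fps_X_power_mult_right_nth)
  then have "{p \<in> I. (case p of (i, j) \<Rightarrow> g i j * fps_const (fps_const fps_X) ^ (2 * i) *
      fps_const fps_X ^ j) $ c $ b $ a \<noteq> 0} \<subseteq> {..a} \<times> {..b}"
    by (auto split: if_splits)
  then show "finite {p \<in> I. (case p of (i, j) \<Rightarrow> g i j * fps_const (fps_const fps_X) ^ (2 * i) *
      fps_const fps_X ^ j) $ c $ b $ a \<noteq> 0}"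
    by (rule finite_subset) simp
qed

text \<open>
  The library defines \<open>inverse\<close> and \<open>/\<close> also for power series over a ring of power series. There
  they have their usual meaning for denominators with invertible constant coefficient; all
  denominators occurring here are of this kind.
\<close>

lemma fps_mult_inverse:
  fixes f :: "'a::{comm_ring_1, inverse} fps"
  assumes "f $ 0 * inverse (f $ 0) = 1"
  shows "f * inverse f = 1"
  unfolding fps_inverse_def using assms by (rule fps_right_inverse)

lemma fps_divide_conv_mult_inverse:
  fixes f g :: "'a::{comm_ring_1, inverse} fps"
  assumes "f $ 0 \<noteq> 0"
  shows "g / f = g * inverse f"
  using assms by (simp add: fps_divide_def)

lemma fps2_divide:
  fixes f g :: "'a::field fps fps"
  assumes "f $ 0 $ 0 \<noteq> 0"
  shows "f * inverse f = 1" and "g / f = g * inverse f"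
proof -
  have "f $ 0 * inverse (f $ 0) = 1"
    using assms by (intro fps_mult_inverse) simp
  then show "f * inverse f = 1"
    by (rule fps_mult_inverse)
  show "g / f = g * inverse f"
    using assms by (intro fps_divide_conv_mult_inverse) auto
qed

lemma fps3_divide:
  fixes f g :: "'a::field fps fps fps"
  assumes "f $ 0 $ 0 $ 0 \<noteq> 0"
  shows "f * inverse f = 1" and "g / f = g * inverse f"
proof -
  show "f * inverse f = 1"
    using assms by (intro fps_mult_inverse fps2_divide)
  show "g / f = g * inverse f"
    using assms by (intro fps_divide_conv_mult_inverse) auto
qed

end

theory Submission
  imports Defs
begin

text \<open>
  Consider weakly increasing words with one letter per position of $\pi$, where an odd letter may be
  repeated only at ascents of $\pi$ and an even letter only at descents. The number $U_m(\pi)$ of such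
  words over $\{1,\dots,m\}$ has the generating function
  $\frac{1}{2(1-s)^2} \frac{(1+s^2)^n}{(1-s^2)^{n-1}} \bigl(\frac{2s}{1+s^2}\bigr)^{\mathrm{udr}(\pi)}$
  in $s$: reading the word from left to right, every step contributes $\frac{1+s^2}{1-s^2}$ if the direction
  of $\pi$ is kept and $\frac{2s}{1-s^2}$ if it changes. Exchanging the roles of odd and even letters
  and taking only the alphabets $\{1,\dots,2j\}$ gives numbers $V_j(\pi)$ whose generating function in $t$ is
  $\frac12 \bigl(\frac{1+t}{1-t}\bigr)^{n+1} \bigl(\frac{4t}{(1+t)^2}\bigr)^{\mathrm{pk}(\pi)+1}$.

  By standardization, $\sum_\pi U_m(\pi) V_j(\pi^{-1})$ counts the weakly increasing words of length
  $n$ over a chain of $2mj$ pairs of letters, half of which may be repeated and half of which may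
  not, so it is the coefficient of $x^n$ in $\bigl(\frac{1+x}{1-x}\bigr)^{mj}$. This is (a).
  The same coefficient is $\frac{1}{n!} \sum_k d(n,k) (2mj)^k$, since both sides satisfy
  $e_{n+2} = 2mj\, e_{n+1} + n(n+1) e_n$ after multiplication by $n!$. Summing the powers $m^k$ and
  $j^k$ against $s^m t^j$ gives (b), and, since $\sum_\pi U_m(\pi) = m^k$ and
  $\sum_\pi V_j(\pi) = (2j)^k$ over the permutations of $k$ elements, also (c) after an injective
  substitution.
\<close>

section \<open>Words and standardization\<close>

text \<open>Letters of two kinds turn a change of direction into parity. If \<pi> ascends at a step,
  words ending in the odd letter 2k+1 or in the next even letter 2k+2 have the same possible
  prefixes, those over {1..2k+1}; at a descent this holds for 2k and 2k+1. So each step projects the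
  generating function onto one parity of the alphabet size. Apart from factors even in s, what is
  projected is (1+s)^2 s^(c+1) with c the number of changes so far: a step keeping the direction
  retains s^(c+1) (1+s^2), a step changing it retains 2 s^(c+2).

  The substitutions turn 1 - S^2 and 1 - T into the squares of (1-s^2)/(1+s^2) and (1-t)/(1+t).
  Hence the power (n-k)/2 in (c): it supplies the factors by which the prefactors for n and for k
  differ. The sum 2^k A_k(s^2) + s B_k(s^2) in (b) is the series of m^k s^m split into even and odd
  m.

  Division of nested power series is meaningful only for units, so the identities are proved with
  cleared denominators and the quotients enter at the end.\<close>

definition ascent :: "(nat \<Rightarrow> nat) \<Rightarrow> nat \<Rightarrow> bool" where
  "ascent \<pi> i \<longleftrightarrow> \<pi> i < \<pi> (i + 1)"

text \<open>
  The letters satisfying \<open>\<phi>\<close> may be repeated where \<open>d\<close> holds, the other ones where it fails. Lists are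
  indexed from 0, but \<open>d\<close> is indexed by positions of a permutation: \<open>d i\<close> concerns the letters with
  list indices \<open>i - 1\<close> and \<open>i\<close>.
\<close>

definition chain_words :: "(nat \<Rightarrow> bool) \<Rightarrow> (nat \<Rightarrow> bool) \<Rightarrow> nat set \<Rightarrow> nat \<Rightarrow> nat list set" where
  "chain_words \<phi> d L n = {w. length w = n \<and> set w \<subseteq> L \<and>
     (\<forall>i \<in> {1..<n}. w ! (i - 1) < w ! i \<or> w ! (i - 1) = w ! i \<and> \<phi> (w ! i) = d i)}"

text \<open>Equal letters with \<open>\<phi>\<close> are ranked from left to right and the others
  from right to left, so that after sorting a tie at \<open>\<phi>\<close> is an ascent of the
  inverse of the \<open>standardization\<close> and any other tie a descent.\<close>

definition std_less :: "(nat \<Rightarrow> bool) \<Rightarrow> nat list \<Rightarrow> nat \<Rightarrow> nat \<Rightarrow> bool" where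
  "std_less \<phi> h i j \<longleftrightarrow> h ! (i - 1) < h ! (j - 1) \<or>
     h ! (i - 1) = h ! (j - 1) \<and> (if \<phi> (h ! (i - 1)) then i < j else j < i)"

definition standardization :: "(nat \<Rightarrow> bool) \<Rightarrow> nat list \<Rightarrow> nat \<Rightarrow> nat" where
  "standardization \<phi> h i =
     (if i \<in> {1..length h} then Suc (card {k \<in> {1..length h}. std_less \<phi> h k i}) else i)"

lemma std_less_trans: "std_less \<phi> h i j \<Longrightarrow> std_less \<phi> h j k \<Longrightarrow> std_less \<phi> h i k"
  by (auto simp: std_less_def split: if_splits)

lemma std_less_irrefl: "\<not> std_less \<phi> h i i"
  by (auto simp: std_less_def)

lemma std_less_total: "i \<noteq> j \<Longrightarrow> std_less \<phi> h i j \<or> std_less \<phi> h j i"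
  unfolding std_less_def by (cases "h ! (i - 1)" "h ! (j - 1)" rule: linorder_cases) auto

lemma standardization_less_iff:
  assumes "i \<in> {1..length h}" "j \<in> {1..length h}"
  shows "standardization \<phi> h i < standardization \<phi> h j \<longleftrightarrow> std_less \<phi> h i j"
proof -
  have mono: "standardization \<phi> h a < standardization \<phi> h b"
    if "std_less \<phi> h a b" "a \<in> {1..length h}" "b \<in> {1..length h}" for a b
  proof -
    have "{k \<in> {1..length h}. std_less \<phi> h k a} \<subset> {k \<in> {1..length h}. std_less \<phi> h k b}"
      using that std_less_trans[of \<phi> h _ a b] std_less_irrefl[of \<phi> h a] by blast
    from psubset_card_mono[OF _ this] show ?thesis
      using that by (simp add: standardization_def)
  qed
  show ?thesis
    using mono[of i j] mono[of j i] std_less_total[of i j \<phi> h] assms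
    by (metis less_asym less_irrefl)
qed

lemma standardization_permutes: "standardization \<phi> h permutes {1..length h}"
proof (rule bij_imp_permutes)
  let ?n = "length h"
  have inj: "inj_on (standardization \<phi> h) {1..?n}"
    by (rule inj_onI) (metis less_irrefl standardization_less_iff std_less_total)
  have "standardization \<phi> h i \<in> {1..?n}" if "i \<in> {1..?n}" for i
  proof -
    have "{k \<in> {1..?n}. std_less \<phi> h k i} \<subset> {1..?n}"
      using that std_less_irrefl by blast
    from psubset_card_mono[OF _ this] show ?thesis
      using that by (simp add: standardization_def)
  qed
  then have "standardization \<phi> h ` {1..?n} = {1..?n}"
    using inj by (intro endo_inj_surj) auto
  then show "bij_betw (standardization \<phi> h) {1..?n} {1..?n}"
    using inj by (simp add: bij_betw_def)
qed (auto simp: standardization_def)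

text \<open>Used to recognize \<pi> as a \<open>standardization\<close>: it suffices that its values
  order the positions as \<open>std_less\<close> does.\<close>

lemma permutes_eq_rank:
  assumes "\<pi> permutes {1..n}" "i \<in> {1..n}"
  shows "\<pi> i = Suc (card {k \<in> {1..n}. \<pi> k < \<pi> i})"
proof -
  have "\<pi> ` {k \<in> {1..n}. \<pi> k < \<pi> i} = {1..<\<pi> i}"
  proof (intro equalityI subsetI)
    fix y assume "y \<in> {1..<\<pi> i}"
    moreover have "\<pi> i \<le> n"
      using assms permutes_in_image by fastforce
    ultimately have "y \<in> \<pi> ` {1..n}"
      using permutes_image[OF assms(1)] by simp
    then show "y \<in> \<pi> ` {k \<in> {1..n}. \<pi> k < \<pi> i}"
      using \<open>y \<in> {1..<\<pi> i}\<close> by auto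
  qed (use permutes_in_image[OF assms(1)] in fastforce)
  then have "card {1..<\<pi> i} = card {k \<in> {1..n}. \<pi> k < \<pi> i}"
    by (metis card_image inj_on_subset permutes_inj[OF assms(1)] subset_UNIV)
  moreover have "\<pi> i \<ge> 1"
    using assms permutes_in_image by fastforce
  ultimately show ?thesis by simp
qed

text \<open>If the letters at \<open>a\<close> and \<open>b\<close> agree, the word is constant in
  between, so all steps there have the direction prescribed by this one letter. The last alternative
  is a negated \<open><\<close> because \<sigma> need not be injective here.\<close>

lemma chain_words_less:
  assumes "w \<in> chain_words \<phi> (ascent \<sigma>) L n" "1 \<le> a" "a < b" "b \<le> n"
  shows "w ! (a - 1) < w ! (b - 1) \<or> w ! (a - 1) = w ! (b - 1) \<and>
    (if \<phi> (w ! (a - 1)) then \<sigma> a < \<sigma> b else \<not> \<sigma> a < \<sigma> b)"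
proof -
  have step: "w ! (i - 1) < w ! i \<or> w ! (i - 1) = w ! i \<and> \<phi> (w ! i) = (\<sigma> i < \<sigma> (i + 1))"
    if "i \<in> {1..<n}" for i
    using assms(1) that by (simp add: chain_words_def ascent_def)
  from assms(3) have "Suc a \<le> b" by simp
  then show ?thesis using assms(4)
  proof (induction b rule: dec_induct)
    case base
    then show ?case using step[of a] assms(2) by auto
  next
    case (step b)
    then show ?case using \<open>\<And>i. i \<in> {1..<n} \<Longrightarrow> _ i\<close>[of b] assms(2)
      by (auto split: if_splits)
  qed
qed

text \<open>By \<open>chain_words_less\<close> for \<open>inv \<pi>\<close>, \<pi>(i) < \<pi>(j)
  implies \<open>std_less\<close> between i and j. Both are strict total orders on the positions, so
  they coincide, and so do the ranks.\<close>

lemma standardization_unique: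
  assumes \<pi>: "\<pi> permutes {1..n}" and w: "w \<in> chain_words \<phi> (ascent (inv \<pi>)) L n"
    and h: "h = map (\<lambda>i. w ! (\<pi> i - 1)) [1..<Suc n]"
  shows "standardization \<phi> h = \<pi>"
proof
  fix i
  have len: "length h = n" by (simp add: h)
  have nth: "h ! (i - 1) = w ! (\<pi> i - 1)" if "i \<in> {1..n}" for i
    using that by (auto simp: h nth_append simp del: upt_Suc)
  have less: "std_less \<phi> h i j" if "i \<in> {1..n}" "j \<in> {1..n}" "\<pi> i < \<pi> j" for i j
  proof -
    have "1 \<le> \<pi> i" "\<pi> j \<le> n"
      using permutes_in_image[OF \<pi>] that by fastforce+
    moreover have "i \<noteq> j" using that by auto
    ultimately show ?thesis
      using chain_words_less[OF w, of "\<pi> i" "\<pi> j"] that nth permutes_inverses[OF \<pi>]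
      by (auto simp: std_less_def split: if_splits)
  qed
  have iff: "std_less \<phi> h i j \<longleftrightarrow> \<pi> i < \<pi> j" if "i \<in> {1..n}" "j \<in> {1..n}" for i j
    using less[of i j] less[of j i] that std_less_irrefl std_less_trans
    by (metis linorder_neqE_nat permutes_inj[OF \<pi>] injD)
  show "standardization \<phi> h i = \<pi> i"
  proof (cases "i \<in> {1..n}")
    case True
    have "{k \<in> {1..n}. std_less \<phi> h k i} = {k \<in> {1..n}. \<pi> k < \<pi> i}"
      using iff True by blast
    then show ?thesis
      using permutes_eq_rank[OF \<pi> True] True by (simp add: standardization_def len)
  next
    case False
    then show ?thesis
      using permutes_not_in[OF \<pi> False] by (auto simp: standardization_def len)
  qed
qed

text \<open>The word reads off the letters of \<open>h\<close> in the order \<open>std_less\<close>.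
  Neighbours then increase or tie, and the tie-breaking rule is exactly the condition on
  \<open>ascent (inv \<pi>)\<close>.\<close>

lemma standardization_chain_word:
  assumes "set h \<subseteq> L" and len: "length h = n" and \<pi>: "\<pi> = standardization \<phi> h"
  shows "map (\<lambda>k. h ! (inv \<pi> k - 1)) [1..<Suc n] \<in> chain_words \<phi> (ascent (inv \<pi>)) L n"
    (is "?w \<in> _")
proof -
  have perm: "\<pi> permutes {1..n}"
    using standardization_permutes len \<pi> by blast
  have inv_in: "inv \<pi> k \<in> {1..n}" if "k \<in> {1..n}" for k
    using permutes_in_image[OF permutes_inv[OF perm]] that by blast
  have nth: "?w ! (k - 1) = h ! (inv \<pi> k - 1)" if "k \<in> {1..n}" for k
    using that by (auto simp del: upt_Suc)
  have "?w ! (i - 1) < ?w ! i \<or> ?w ! (i - 1) = ?w ! i \<and> \<phi> (?w ! i) = ascent (inv \<pi>) i"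
    if i: "i \<in> {1..<n}" for i
  proof -
    have in_range: "i \<in> {1..n}" "Suc i \<in> {1..n}" using i by auto
    have "\<pi> (inv \<pi> i) < \<pi> (inv \<pi> (Suc i))"
      by (simp add: permutes_inverses[OF perm])
    then have "std_less \<phi> h (inv \<pi> i) (inv \<pi> (Suc i))"
      using standardization_less_iff[of "inv \<pi> i" h "inv \<pi> (Suc i)" \<phi>] inv_in in_range
      unfolding \<pi>[symmetric] len by blast
    then show ?thesis
      using nth[of i] nth[of "Suc i"] in_range
      by (auto simp: std_less_def ascent_def split: if_splits)
  qed
  moreover have "set ?w \<subseteq> L"
  proof -
    have "h ! (inv \<pi> k - 1) \<in> set h" if "k \<in> {1..n}" for k
    proof -
      have "inv \<pi> k - 1 < length h" using inv_in[OF that] len by auto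
      then show ?thesis by (rule nth_mem)
    qed
    then show ?thesis using assms(1) by (auto simp del: upt_Suc)
  qed
  ultimately show ?thesis by (simp add: chain_words_def)
qed

lemma finite_chain_words: "finite L \<Longrightarrow> finite (chain_words \<phi> d L n)"
  by (rule finite_subset[OF _ finite_lists_length_eq[of L n]]) (auto simp: chain_words_def)

text \<open>Pairs of a permutation and a chain word for its inverse correspond to arbitrary words
  \<open>h\<close>: unsort the chain word along \<pi>, or sort \<open>h\<close> and keep its
  \<open>standardization\<close>. The weight \<open>F\<close> leaves room for a second factor
  depending on \<pi> alone.\<close>

lemma sum_standardization:
  fixes F :: "(nat \<Rightarrow> nat) \<Rightarrow> nat"
  assumes "finite L"
  shows "(\<Sum>\<pi> | \<pi> permutes {1..n}. card (chain_words \<phi> (ascent (inv \<pi>)) L n) * F \<pi>) =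
    (\<Sum>h | set h \<subseteq> L \<and> length h = n. F (standardization \<phi> h))"
proof -
  let ?S = "SIGMA \<pi>:{\<pi>. \<pi> permutes {1..n}}. chain_words \<phi> (ascent (inv \<pi>)) L n"
  let ?i = "\<lambda>h. (standardization \<phi> h,
    map (\<lambda>k. h ! (inv (standardization \<phi> h) k - 1)) [1..<Suc n])"
  let ?j = "\<lambda>(\<pi>, w). map (\<lambda>i. w ! (\<pi> i - 1)) [1..<Suc n]"
  have "(\<Sum>\<pi> | \<pi> permutes {1..n}. card (chain_words \<phi> (ascent (inv \<pi>)) L n) * F \<pi>) =
      (\<Sum>\<pi> | \<pi> permutes {1..n}. \<Sum>w \<in> chain_words \<phi> (ascent (inv \<pi>)) L n. F \<pi>)"
    by simp
  also have "\<dots> = (\<Sum>(\<pi>, w) \<in> ?S. F \<pi>)"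
    using assms by (intro sum.Sigma) (auto simp: finite_permutations finite_chain_words)
  also have "\<dots> = (\<Sum>h | set h \<subseteq> L \<and> length h = n. F (standardization \<phi> h))"
  proof (rule sum.reindex_bij_witness[where i = ?i and j = ?j])
    fix p assume "p \<in> ?S"
    then obtain \<pi> w where p: "p = (\<pi>, w)" "\<pi> permutes {1..n}"
        "w \<in> chain_words \<phi> (ascent (inv \<pi>)) L n" by auto
    note std = standardization_unique[OF p(2,3) refl]
    have w: "length w = n" "set w \<subseteq> L" using p(3) by (auto simp: chain_words_def)
    have in_range: "\<pi> i \<in> {1..n}" if "i \<in> {1..n}" for i
      using permutes_in_image[OF p(2)] that by blast
    have inv_in: "inv \<pi> k \<in> {1..n}" if "k \<in> {1..n}" for k
      using permutes_in_image[OF permutes_inv[OF p(2)]] that by blast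
    have "map (\<lambda>k. ?j p ! (inv \<pi> k - 1)) [1..<Suc n] = w"
    proof (rule nth_equalityI)
      fix k assume "k < length (map (\<lambda>k. ?j p ! (inv \<pi> k - 1)) [1..<Suc n])"
      then have k: "Suc k \<in> {1..n}" by (auto simp del: upt_Suc)
      then show "map (\<lambda>k. ?j p ! (inv \<pi> k - 1)) [1..<Suc n] ! k = w ! k"
        using inv_in[OF k] permutes_inverses[OF p(2)]
        by (auto simp: p(1) simp del: upt_Suc)
    qed (simp add: w)
    then show "?i (?j p) = p"
      using std by (simp add: p(1) del: upt_Suc)
    have "w ! (\<pi> i - 1) \<in> set w" if "i \<in> {1..n}" for i
    proof -
      have "\<pi> i - 1 < length w" using in_range[OF that] w by auto
      then show ?thesis by (rule nth_mem)
    qed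
    then show "?j p \<in> {h. set h \<subseteq> L \<and> length h = n}"
      using w by (auto simp: p(1) simp del: upt_Suc)
    show "F (standardization \<phi> (?j p)) = (case p of (\<pi>, w) \<Rightarrow> F \<pi>)"
      using std by (simp add: p(1) del: upt_Suc)
  next
    fix h assume "h \<in> {h. set h \<subseteq> L \<and> length h = n}"
    then have h: "set h \<subseteq> L" "length h = n" by auto
    define \<pi> where "\<pi> = standardization \<phi> h"
    have perm: "\<pi> permutes {1..n}"
      using standardization_permutes h(2) \<pi>_def by blast
    have in_range: "\<pi> i \<in> {1..n}" if "i \<in> {1..n}" for i
      using permutes_in_image[OF perm] that by blast
    show "?j (?i h) = h"
    proof (rule nth_equalityI)
      fix k assume "k < length (?j (?i h))"
      then have k: "Suc k \<in> {1..n}" by (auto simp del: upt_Suc)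
      then show "?j (?i h) ! k = h ! k"
        using in_range[OF k] permutes_inverses[OF perm]
        unfolding \<pi>_def[symmetric] by (auto simp del: upt_Suc)
    qed (simp add: h)
    show "?i h \<in> ?S"
      using standardization_chain_word[OF h refl] perm by (simp add: \<pi>_def del: upt_Suc)
  qed
  finally show ?thesis .
qed

section \<open>Sorted two-rowed arrays\<close>

lemma chain_words_cong:
  assumes "\<And>i. i \<in> {1..<n} \<Longrightarrow> d i = d' i"
  shows "chain_words \<phi> d L n = chain_words \<phi> d' L n"
  using assms by (auto simp: chain_words_def)

definition sorted_words :: "('a \<Rightarrow> 'a \<Rightarrow> bool) \<Rightarrow> 'a set \<Rightarrow> nat \<Rightarrow> 'a list set" where
  "sorted_words R A n = {w. set w \<subseteq> A \<and> length w = n \<and> sorted_wrt R w}"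

text \<open>The order in which the columns \<open>(a, b)\<close> of a two-rowed array of chain words appear.\<close>

definition pair_rel :: "(nat \<Rightarrow> bool) \<Rightarrow> (nat \<Rightarrow> bool) \<Rightarrow> nat \<times> nat \<Rightarrow> nat \<times> nat \<Rightarrow> bool" where
  "pair_rel \<psi> \<phi> p q \<longleftrightarrow> fst p < fst q \<or> fst p = fst q \<and>
     (if \<psi> (fst p) then snd p < snd q \<or> snd p = snd q \<and> \<phi> (snd p)
      else snd q < snd p \<or> snd p = snd q \<and> \<not> \<phi> (snd p))"

lemma transp_pair_rel: "transp (pair_rel \<psi> \<phi>)"
  by (rule transpI) (auto simp: pair_rel_def split: if_splits)

text \<open>Put a chain word on top of \<open>h\<close>. Where top letters tie, an ascent of the
  \<open>standardization\<close> means that the lower letters increase or tie at a letter with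
  \<open>\<phi>\<close>: for neighbouring positions the tie-breaking by position is already decided,
  so the condition involves only the two columns.\<close>

lemma sum_card_chain_words_standardization:
  assumes "finite L" "finite K"
  shows "(\<Sum>h | set h \<subseteq> L \<and> length h = n.
      card (chain_words \<psi> (ascent (standardization \<phi> h)) K n)) =
    card (sorted_words (pair_rel \<psi> \<phi>) (K \<times> L) n)"
proof -
  let ?H = "{h. set h \<subseteq> L \<and> length h = n}"
  let ?S = "SIGMA h:?H. chain_words \<psi> (ascent (standardization \<phi> h)) K n"
  have "bij_betw (\<lambda>(h, w). zip w h) ?S (sorted_words (pair_rel \<psi> \<phi>) (K \<times> L) n)"
  proof (rule bij_betwI[where g = "\<lambda>p. (map snd p, map fst p)"])
    have adj: "(\<forall>i\<in>{1..<n}. w ! (i - 1) < w ! i \<or>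
        w ! (i - 1) = w ! i \<and> \<psi> (w ! i) = ascent (standardization \<phi> h) i) \<longleftrightarrow>
        sorted_wrt (pair_rel \<psi> \<phi>) (zip w h)" if "length h = n" "length w = n" for h w
    proof -
      have "(w ! i < w ! Suc i \<or>
          w ! i = w ! Suc i \<and> \<psi> (w ! Suc i) = ascent (standardization \<phi> h) (Suc i)) \<longleftrightarrow>
          pair_rel \<psi> \<phi> (zip w h ! i) (zip w h ! Suc i)" if "Suc i < n" for i
        using standardization_less_iff[of "Suc i" h "Suc (Suc i)" \<phi>] that
          \<open>length h = n\<close> \<open>length w = n\<close>
        by (auto simp: ascent_def pair_rel_def std_less_def)
      moreover have shift: "(\<forall>i\<in>{1..<n}. P (i - 1) i) \<longleftrightarrow> (\<forall>i. Suc i < n \<longrightarrow> P i (Suc i))"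
        for P :: "nat \<Rightarrow> nat \<Rightarrow> bool"
      proof (intro iffI ballI allI impI)
        fix i assume "\<forall>i\<in>{1..<n}. P (i - 1) i" "Suc i < n"
        then show "P i (Suc i)" by (fastforce dest!: bspec[where x = "Suc i"])
      next
        fix i assume "\<forall>i. Suc i < n \<longrightarrow> P i (Suc i)" "i \<in> {1..<n}"
        then show "P (i - 1) i" by (cases i) auto
      qed
      ultimately show ?thesis
        using that unfolding sorted_wrt_iff_nth_Suc_transp[OF transp_pair_rel]
        by (subst shift) auto
    qed
    show "(\<lambda>(h, w). zip w h) \<in> ?S \<rightarrow> sorted_words (pair_rel \<psi> \<phi>) (K \<times> L) n"
      using adj by (auto simp: chain_words_def sorted_words_def dest: set_zip_leftD set_zip_rightD)
    show "(\<lambda>p. (map snd p, map fst p)) \<in> sorted_words (pair_rel \<psi> \<phi>) (K \<times> L) n \<rightarrow> ?S"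
    proof
      fix p assume "p \<in> sorted_words (pair_rel \<psi> \<phi>) (K \<times> L) n"
      then show "(map snd p, map fst p) \<in> ?S"
        using adj[of "map snd p" "map fst p"]
        by (auto simp: sorted_words_def chain_words_def zip_map_fst_snd)
    qed
  qed (auto simp: chain_words_def sorted_words_def zip_map_fst_snd)
  then have "card ?S = card (sorted_words (pair_rel \<psi> \<phi>) (K \<times> L) n)"
    by (rule bij_betw_same_card)
  then show ?thesis
    using assms by (simp add: card_SigmaI finite_lists_length_eq finite_chain_words)
qed

lemma finite_sorted_words: "finite A \<Longrightarrow> finite (sorted_words R A n)"
  by (rule finite_subset[OF _ finite_lists_length_eq[of A n]]) (auto simp: sorted_words_def)

lemma sorted_words_0: "sorted_words R A 0 = {[]}"
  by (auto simp: sorted_words_def)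

text \<open>Since \<open>l\<close> comes before all of \<open>A\<close> and never after, it occurs
  in a sorted word only as an initial block; the words are split by whether they start with
  \<open>l\<close>. After a first \<open>l\<close>, further ones are allowed iff
  \<open>R l l\<close>.\<close>

lemma card_sorted_words_insert:
  assumes "finite A" and less: "\<And>x. x \<in> A \<Longrightarrow> R l x \<and> \<not> R x l"
  shows "card (sorted_words R (insert l A) (Suc n)) =
    card (sorted_words R (if R l l then insert l A else A) n) + card (sorted_words R A (Suc n))"
proof -
  let ?B = "if R l l then insert l A else A"
  have "l \<notin> A" using less by blast
  have "sorted_words R (insert l A) (Suc n) =
      (#) l ` sorted_words R ?B n \<union> sorted_words R A (Suc n)"
  proof (intro equalityI subsetI)
    fix w assume w: "w \<in> sorted_words R (insert l A) (Suc n)"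
    then obtain y v where v: "w = y # v"
      by (cases w) (auto simp: sorted_words_def)
    show "w \<in> (#) l ` sorted_words R ?B n \<union> sorted_words R A (Suc n)"
    proof (cases "y = l")
      case True
      then have "v \<in> sorted_words R ?B n"
        using w by (auto simp: v sorted_words_def)
      then show ?thesis using True v by blast
    next
      case False
      then show ?thesis using w less by (auto simp: v sorted_words_def)
    qed
  next
    fix w assume "w \<in> (#) l ` sorted_words R ?B n \<union> sorted_words R A (Suc n)"
    then consider v where "w = l # v" "v \<in> sorted_words R ?B n" | "w \<in> sorted_words R A (Suc n)"
      by blast
    then show "w \<in> sorted_words R (insert l A) (Suc n)"
    proof cases
      case 1
      have "R l x \<and> x \<in> insert l A" if "x \<in> ?B" for x
        using that less by (auto split: if_splits)
      then have "\<forall>x \<in> set v. R l x \<and> x \<in> insert l A"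
        using 1(2) unfolding sorted_words_def by blast
      then show ?thesis
        using 1 unfolding sorted_words_def by auto
    next
      case 2
      then show ?thesis by (auto simp: sorted_words_def)
    qed
  qed
  moreover have "(#) l ` sorted_words R ?B n \<inter> sorted_words R A (Suc n) = {}"
  proof -
    have "l \<notin> set w" if "w \<in> sorted_words R A (Suc n)" for w
      using that \<open>l \<notin> A\<close> by (auto simp: sorted_words_def)
    then show ?thesis by force
  qed
  moreover have "finite ?B" using \<open>finite A\<close> by simp
  ultimately show ?thesis
    using \<open>finite A\<close>
    by (simp add: card_Un_disjoint finite_sorted_words card_image del: if_split)
qed

text \<open>Letters contribute independently: a repeatable one any multiplicity, a non-repeatable
  one at most 1.\<close>

lemma sorted_words_series:
  assumes "sorted_wrt (\<lambda>x y. R x y \<and> \<not> R y x) ls"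
  shows "Abs_fps (\<lambda>n. of_nat (card (sorted_words R (set ls) n))) =
    (\<Prod>l\<leftarrow>ls. if R l l then inverse (1 - fps_X) else 1 + fps_X :: rat fps)"
  using assms
proof (induction ls)
  case Nil
  then show ?case
  proof -
    have "sorted_words R {} n = (if n = 0 then {[]} else {})" for n
      by (auto simp: sorted_words_def)
    then show ?thesis by (simp add: fps_eq_iff)
  qed
next
  case (Cons l ls)
  define W where "W A = Abs_fps (\<lambda>n. of_nat (card (sorted_words R A n)) :: rat)" for A
  have less: "\<And>x. x \<in> set ls \<Longrightarrow> R l x \<and> \<not> R x l"
    using Cons.prems by auto
  have card: "card (sorted_words R (insert l (set ls)) (Suc n)) =
      card (sorted_words R (if R l l then insert l (set ls) else set ls) n) +
      card (sorted_words R (set ls) (Suc n))" for n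
    by (rule card_sorted_words_insert) (use less in auto)
  have W: "W (insert l (set ls)) =
      W (set ls) + fps_X * W (if R l l then insert l (set ls) else set ls)"
  proof (rule fps_ext)
    fix n show "W (insert l (set ls)) $ n =
      (W (set ls) + fps_X * W (if R l l then insert l (set ls) else set ls)) $ n"
      by (cases n) (simp_all only: W_def card fps_add_nth fps_X_mult_nth fps_nth_Abs_fps
          sorted_words_0, simp_all)
  qed
  have IH: "W (set ls) = (\<Prod>l\<leftarrow>ls. if R l l then inverse (1 - fps_X) else 1 + fps_X)"
    using Cons by (simp add: W_def)
  have "W (insert l (set ls)) = (if R l l then inverse (1 - fps_X) else 1 + fps_X) * W (set ls)"
  proof (cases "R l l")
    case True
    then have "(1 - fps_X) * W (insert l (set ls)) = W (set ls)"
      using W by (simp add: algebra_simps)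
    then have "inverse (1 - fps_X) * (1 - fps_X) * W (insert l (set ls)) =
        inverse (1 - fps_X) * W (set ls)"
      by (simp only: mult.assoc)
    moreover have "inverse (1 - fps_X) * (1 - fps_X) = (1 :: rat fps)"
      by (rule inverse_mult_eq_1) simp
    ultimately show ?thesis
      using True by simp
  qed (use W in \<open>simp add: algebra_simps\<close>)
  then show ?case using IH by (simp add: W_def)
qed

lemma parity_prod_list:
  fixes f g :: "'a :: comm_monoid_mult"
  shows "(\<Prod>b\<leftarrow>[1..<Suc (2 * j)]. if P = even b then f else g) = (g * f) ^ j"
proof (induction j)
  case (Suc j)
  have "[1..<Suc (2 * Suc j)] = [1..<Suc (2 * j)] @ [Suc (2 * j), Suc (Suc (2 * j))]"
    by simp
  then show ?case
    using Suc by (cases P) (simp_all add: mult_ac del: upt_Suc)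
qed simp

text \<open>
  A pair \<open>(a, b)\<close> may be repeated iff \<open>\<psi> a = even b\<close>, so each \<open>a\<close> contributes \<open>j\<close> repeatable and
  \<open>j\<close> non-repeatable pairs, whatever \<open>\<psi>\<close> is.
\<close>

lemma sorted_words_pair_rel_series:
  "Abs_fps (\<lambda>n. of_nat (card (sorted_words (pair_rel \<psi> even) ({1..m} \<times> {1..2 * j}) n))) =
    (((1 + fps_X) / (1 - fps_X)) ^ (m * j) :: rat fps)"
proof -
  \<comment> \<open>For a fixed first component, \<open>pair_rel\<close> increases in the second one
    if \<open>\<psi> a\<close> and decreases otherwise.\<close>
  define block where "block a = map (Pair a) (if \<psi> a then [1..<Suc (2 * j)] else rev [1..<Suc (2 * j)])" for a
  define ls where "ls m = concat (map block [1..<Suc m])" for m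
  have set_block: "set (block a) = {a} \<times> {1..2 * j}" for a
    by (auto simp: block_def simp del: upt_Suc)
  have ls_Suc: "ls (Suc m) = ls m @ block (Suc m)" for m
    by (simp add: ls_def)
  have set_ls: "set (ls m) = {1..m} \<times> {1..2 * j}" for m
    by (auto simp: ls_def set_block)
  have sorted_block: "sorted_wrt (\<lambda>x y. pair_rel \<psi> even x y \<and> \<not> pair_rel \<psi> even y x) (block a)" for a
  proof -
    have "sorted_wrt (<) [1..<Suc (2 * j)]" by (rule sorted_wrt_upt)
    then have "sorted_wrt (\<lambda>x y. x < y \<and> \<not> y < x) [1..<Suc (2 * j)]"
      by (rule sorted_wrt_mono_rel[rotated]) auto
    then show ?thesis
      by (cases "\<psi> a")
        (auto simp: block_def sorted_wrt_map pair_rel_def sorted_wrt_rev simp del: upt_Suc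
          elim: sorted_wrt_mono_rel[rotated])
  qed
  have "sorted_wrt (\<lambda>x y. pair_rel \<psi> even x y \<and> \<not> pair_rel \<psi> even y x) (ls m)" for m
  proof (induction m)
    case (Suc m)
    then show ?case
      by (auto simp: ls_Suc sorted_wrt_append sorted_block set_ls set_block)
        (auto simp: pair_rel_def)
  qed (simp add: ls_def)
  note series = sorted_words_series[OF this]
  let ?f = "\<lambda>l. if pair_rel \<psi> even l l then inverse (1 - fps_X) else 1 + fps_X :: rat fps"
  have block: "(\<Prod>l\<leftarrow>block a. ?f l) = ((1 + fps_X) * inverse (1 - fps_X)) ^ j" for a
  proof -
    have "?f (a, b) = (if \<psi> a = even b then inverse (1 - fps_X) else 1 + fps_X)" for b
      by (auto simp: pair_rel_def)
    then have "(\<Prod>l\<leftarrow>block a. ?f l) =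
        (\<Prod>b\<leftarrow>[1..<Suc (2 * j)]. if \<psi> a = even b then inverse (1 - fps_X) else 1 + fps_X)"
      by (simp add: block_def o_def rev_map[symmetric] prod_list.rev del: upt_Suc)
    then show ?thesis by (simp only: parity_prod_list)
  qed
  have "(\<Prod>l\<leftarrow>ls m. ?f l) = ((1 + fps_X) * inverse (1 - fps_X)) ^ (m * j)" for m
  proof (induction m)
    case (Suc m)
    then show ?case
      by (simp add: ls_Suc block power_add mult.commute)
  qed (simp add: ls_def)
  then show ?thesis
    using series[of m] by (simp add: set_ls fps_divide_unit)
qed

lemma sum_card_chain_words:
  "of_nat (\<Sum>\<pi> | \<pi> permutes {1..n}. card (chain_words \<psi> (ascent \<pi>) {1..m} n) *
      card (chain_words even (ascent (inv \<pi>)) {1..2 * j} n)) =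
    (((1 + fps_X) / (1 - fps_X) :: rat fps) ^ (m * j)) $ n"
proof -
  have "(\<Sum>\<pi> | \<pi> permutes {1..n}. card (chain_words \<psi> (ascent \<pi>) {1..m} n) *
      card (chain_words even (ascent (inv \<pi>)) {1..2 * j} n)) =
      card (sorted_words (pair_rel \<psi> even) ({1..m} \<times> {1..2 * j}) n)"
    using sum_standardization[of "{1..2*j}" even n "\<lambda>\<pi>. card (chain_words \<psi> (ascent \<pi>) {1..m} n)"]
    by (simp add: sum_card_chain_words_standardization mult.commute)
  then show ?thesis
    unfolding sorted_words_pair_rel_series[of \<psi> m j, symmetric] by simp
qed

text \<open>The total is independent of \<open>\<phi>\<close>; this lets the same power sums
  evaluate \<open>eulerian_A\<close> (all letters repeatable at ascents), \<open>P_udr\<close> and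
  \<open>P_pk\<close>.\<close>

lemma sum_card_chain_words_permutations:
  assumes "finite L"
  shows "(\<Sum>\<pi> | \<pi> permutes {1..n}. card (chain_words \<phi> (ascent \<pi>) L n)) = card L ^ n"
proof -
  have "(\<Sum>\<pi> | \<pi> permutes {1..n}. card (chain_words \<phi> (ascent \<pi>) L n)) =
      (\<Sum>\<pi> | \<pi> permutes {1..n}. card (chain_words \<phi> (ascent (inv \<pi>)) L n))"
    by (rule sum.reindex_bij_witness[where i = inv and j = inv])
      (auto simp: permutes_inv permutes_inv_inv)
  also have "\<dots> = card {h. set h \<subseteq> L \<and> length h = n}"
    using sum_standardization[OF assms, of \<phi> n "\<lambda>_. 1"] by simp
  also have "\<dots> = card L ^ n"
    using assms by (rule card_lists_length_eq)
  finally show ?thesis .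
qed

section \<open>Generating functions of chain words\<close>

lemma chain_words_sorted:
  assumes "w \<in> chain_words \<phi> d L n"
  shows "sorted w"
proof -
  have "w ! i \<le> w ! Suc i" if "Suc i < length w" for i
  proof -
    have "Suc i \<in> {1..<n}" using that assms by (auto simp: chain_words_def)
    moreover have "\<forall>i\<in>{1..<n}. w ! (i - 1) < w ! i \<or> w ! (i - 1) = w ! i \<and> \<phi> (w ! i) = d i"
      using assms by (simp add: chain_words_def)
    ultimately have "w ! (Suc i - 1) < w ! Suc i \<or> w ! (Suc i - 1) = w ! Suc i"
      by blast
    then show ?thesis by auto
  qed
  then show ?thesis by (simp add: sorted_iff_nth_Suc)
qed

lemma chain_words_snoc:
  assumes "1 \<le> n"
  shows "w @ [c] \<in> chain_words \<phi> d L (Suc n) \<longleftrightarrow>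
    w \<in> chain_words \<phi> d L n \<and> c \<in> L \<and> (last w < c \<or> last w = c \<and> \<phi> c = d n)"
proof (cases "length w = n")
  case True
  then have last: "last w = w ! (n - 1)"
    using assms by (subst last_conv_nth) auto
  have "{1..<Suc n} = insert n {1..<n}" using assms by auto
  moreover have "(w @ [c]) ! i = w ! i" "(w @ [c]) ! (i - 1) = w ! (i - 1)" if "i \<in> {1..<n}" for i
    using that True by (auto simp: nth_append)
  moreover have "(w @ [c]) ! (n - 1) = w ! (n - 1)" "(w @ [c]) ! n = c"
    using True assms by (auto simp: nth_append)
  ultimately show ?thesis
    using True last by (auto simp: chain_words_def)
qed (auto simp: chain_words_def)

lemma chain_words_last_le:
  assumes "w \<in> chain_words \<phi> d {1..M} n" "1 \<le> n" "m \<le> M"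
  shows "last w \<le> m \<longleftrightarrow> w \<in> chain_words \<phi> d {1..m} n"
proof -
  have "w \<noteq> []" using assms by (auto simp: chain_words_def)
  moreover have "x \<le> last w" if "x \<in> set w" for x
  proof -
    from that obtain i where "x = w ! i" "i < length w" by (metis in_set_conv_nth)
    then show ?thesis
      using chain_words_sorted[OF assms(1)] \<open>w \<noteq> []\<close>
      by (simp add: last_conv_nth sorted_iff_nth_mono)
  qed
  ultimately have "last w \<le> m \<longleftrightarrow> (\<forall>x \<in> set w. x \<le> m)"
    using last_in_set order_trans by blast
  then show ?thesis
    using assms(1) by (auto simp: chain_words_def)
qed

text \<open>Split by whether the last letter is \<open>Suc m\<close>. If it is, the preceding word
  may end in \<open>Suc m\<close> too iff this letter may be repeated at step \<open>n\<close>;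
  otherwise it lives over \<open>{1..m}\<close>.\<close>

lemma card_chain_words_Suc:
  assumes "1 \<le> n"
  shows "card (chain_words \<phi> d {1..Suc m} (Suc n)) = card (chain_words \<phi> d {1..m} (Suc n)) +
    card (chain_words \<phi> d {1..if \<phi> (Suc m) = d n then Suc m else m} n)"
proof -
  let ?k = "if \<phi> (Suc m) = d n then Suc m else m"
  have mono: "chain_words \<phi> d {1..a} k \<subseteq> chain_words \<phi> d {1..b} k" if "a \<le> b" for a b k
    using that by (auto simp: chain_words_def)
  have "chain_words \<phi> d {1..Suc m} (Suc n) = chain_words \<phi> d {1..m} (Suc n) \<union>
      (\<lambda>w. w @ [Suc m]) ` chain_words \<phi> d {1..?k} n"
  proof (intro equalityI subsetI)
    fix w assume w: "w \<in> chain_words \<phi> d {1..Suc m} (Suc n)"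
    show "w \<in> chain_words \<phi> d {1..m} (Suc n) \<union> (\<lambda>w. w @ [Suc m]) ` chain_words \<phi> d {1..?k} n"
    proof (cases "last w \<le> m")
      case True
      then show ?thesis using chain_words_last_le[OF w, of m] by simp
    next
      case False
      have ne: "w \<noteq> []" using w by (auto simp: chain_words_def)
      moreover have "last w \<le> Suc m"
        using w last_in_set[OF ne] by (auto simp: chain_words_def)
      ultimately have v: "w = butlast w @ [Suc m]"
        using False append_butlast_last_id[OF ne] by (simp add: le_Suc_eq)
      then have b: "butlast w \<in> chain_words \<phi> d {1..Suc m} n"
          "last (butlast w) < Suc m \<or> last (butlast w) = Suc m \<and> \<phi> (Suc m) = d n"
        using w chain_words_snoc[OF assms, of "butlast w" "Suc m" \<phi> d "{1..Suc m}"] by auto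
      then have "last (butlast w) \<le> ?k" by auto
      then have "butlast w \<in> chain_words \<phi> d {1..?k} n"
        using chain_words_last_le[OF b(1) assms, of ?k] by (simp split: if_splits)
      then show ?thesis using v by blast
    qed
  next
    fix w assume "w \<in> chain_words \<phi> d {1..m} (Suc n) \<union>
      (\<lambda>w. w @ [Suc m]) ` chain_words \<phi> d {1..?k} n"
    then show "w \<in> chain_words \<phi> d {1..Suc m} (Suc n)"
    proof
      assume "w \<in> chain_words \<phi> d {1..m} (Suc n)"
      then show ?thesis using mono[of m "Suc m"] by auto
    next
      assume "w \<in> (\<lambda>w. w @ [Suc m]) ` chain_words \<phi> d {1..?k} n"
      then obtain v where v: "w = v @ [Suc m]" "v \<in> chain_words \<phi> d {1..?k} n" by blast
      have v': "v \<in> chain_words \<phi> d {1..Suc m} n"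
        using v(2) mono[of ?k "Suc m"] by (auto split: if_splits)
      have "last v \<le> ?k"
        using chain_words_last_le[OF v' assms, of ?k] v(2) by (simp split: if_splits)
      then have "last v < Suc m \<or> last v = Suc m \<and> \<phi> (Suc m) = d n"
        by (auto split: if_splits)
      then show ?thesis
        using v(1) v' by (simp add: chain_words_snoc[OF assms])
    qed
  qed
  moreover have "chain_words \<phi> d {1..m} (Suc n) \<inter>
      (\<lambda>w. w @ [Suc m]) ` chain_words \<phi> d {1..?k} n = {}"
    by (auto simp: chain_words_def)
  ultimately show ?thesis
    by (simp add: card_Un_disjoint finite_chain_words card_image inj_on_def)
qed

lemma card_chain_words_1: "card (chain_words \<phi> d {1..m} (Suc 0)) = m"
proof -
  have "chain_words \<phi> d {1..m} (Suc 0) = (\<lambda>c. [c]) ` {1..m}"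
    by (auto simp: chain_words_def length_Suc_conv)
  then show ?thesis by (simp add: card_image inj_on_def)
qed

lemma card_chain_words_empty: "card (chain_words \<phi> d {1..0} (Suc n)) = 0"
  by (auto simp: chain_words_def card_eq_0_iff)

text \<open>The variable marks the size of the alphabet, not the length of the words.\<close>

definition chain_words_series ::
    "(nat \<Rightarrow> bool) \<Rightarrow> (nat \<Rightarrow> bool) \<Rightarrow> nat \<Rightarrow> 'a::comm_ring_1 fps" where
  "chain_words_series \<phi> d n = Abs_fps (\<lambda>m. of_nat (card (chain_words \<phi> d {1..m} n)))"

lemma chain_words_series_1: "(1 - fps_X)\<^sup>2 * chain_words_series \<phi> d (Suc 0) = fps_X"
proof -
  have "(1 - fps_X) * chain_words_series \<phi> d (Suc 0) = (Abs_fps (\<lambda>m. if m = 0 then 0 else 1) :: 'a fps)"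
  proof (rule fps_ext)
    fix m
    show "((1 - fps_X) * chain_words_series \<phi> d (Suc 0)) $ m =
        (Abs_fps (\<lambda>m. if m = 0 then 0 else 1) :: 'a fps) $ m"
      by (cases m)
        (simp_all add: chain_words_series_def card_chain_words_1[unfolded One_nat_def] left_diff_distrib)
  qed
  moreover have "(1 - fps_X) * Abs_fps (\<lambda>m. if m = 0 then 0 else 1) = (fps_X :: 'a fps)"
  proof (rule fps_ext)
    fix m
    show "((1 - fps_X) * Abs_fps (\<lambda>m. if m = 0 then 0 else 1)) $ m = (fps_X :: 'a fps) $ m"
      by (cases m) (simp_all add: left_diff_distrib fps_X_nth)
  qed
  ultimately show ?thesis
    by (simp only: power2_eq_square mult.assoc)
qed

text \<open>Multiplication by 1 - X takes differences in the alphabet size, leaving the words whose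
  last letter is the largest one.\<close>

lemma chain_words_series_Suc_nth:
  assumes "1 \<le> n"
  shows "((1 - fps_X) * chain_words_series \<phi> d (Suc n)) $ 0 = (0 :: 'a::comm_ring_1)"
    and "((1 - fps_X :: 'a fps) * chain_words_series \<phi> d (Suc n)) $ Suc m =
      chain_words_series \<phi> d n $ (if \<phi> (Suc m) = d n then Suc m else m)"
  using card_chain_words_Suc[OF assms, of \<phi> d m] card_chain_words_empty[of \<phi> d n]
  by (simp_all add: chain_words_series_def algebra_simps)

text \<open>With letters of one kind only these are P-partitions: steps with \<open>d\<close> may be
  weak, the others are strict, and each strict step costs one factor X. For
  \<open>d = ascent \<pi>\<close> the exponent is des + 1.\<close>

lemma chain_words_series_True:
  "(1 - fps_X) ^ (n + 2) * chain_words_series (\<lambda>_. True) d (Suc n) =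
    fps_X ^ (card {i \<in> {1..n}. \<not> d i} + 1)"
proof (induction n)
  case 0
  then show ?case using chain_words_series_1 by (simp add: power2_eq_square)
next
  case (Suc n)
  have z: "chain_words_series (\<lambda>_. True) d (Suc n) $ 0 = (0 :: 'a)"
    by (simp only: chain_words_series_def fps_nth_Abs_fps card_chain_words_empty, simp)
  have "(1 - fps_X :: 'a fps) * chain_words_series (\<lambda>_. True) d (Suc (Suc n)) =
      (if d (Suc n) then 1 else fps_X) * chain_words_series (\<lambda>_. True) d (Suc n)"
  proof (rule fps_ext)
    fix m
    show "((1 - fps_X :: 'a fps) * chain_words_series (\<lambda>_. True) d (Suc (Suc n))) $ m =
      ((if d (Suc n) then 1 else fps_X) * chain_words_series (\<lambda>_. True) d (Suc n)) $ m"
      using chain_words_series_Suc_nth[of "Suc n" "\<lambda>_. True" d, where 'a = 'a] z by (cases m) auto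
  qed
  moreover have "{i \<in> {1..Suc n}. \<not> d i} =
      (if d (Suc n) then {} else {Suc n}) \<union> {i \<in> {1..n}. \<not> d i}"
    by (auto simp: le_Suc_eq)
  then have "card {i \<in> {1..Suc n}. \<not> d i} = (if d (Suc n) then 0 else 1) + card {i \<in> {1..n}. \<not> d i}"
    by simp
  then have "fps_X ^ (card {i \<in> {1..Suc n}. \<not> d i} + 1) =
      (if d (Suc n) then 1 else fps_X) * (fps_X ^ (card {i \<in> {1..n}. \<not> d i} + 1) :: 'a fps)"
    by simp
  moreover have "(1 - fps_X :: 'a fps) ^ (Suc n + 2) * chain_words_series (\<lambda>_. True) d (Suc (Suc n)) =
      (1 - fps_X) ^ (n + 2) * ((1 - fps_X) * chain_words_series (\<lambda>_. True) d (Suc (Suc n)))"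
    by (simp only: power_Suc add_Suc mult_ac)
  ultimately show ?case
    by (simp only: Suc.IH[symmetric] mult.left_commute)
qed

section \<open>Parity of the alphabet size and changes of direction\<close>

definition parity_part :: "bool \<Rightarrow> 'a::comm_ring_1 fps \<Rightarrow> 'a fps" where
  "parity_part b f = Abs_fps (\<lambda>m. if odd m = b then f $ m else 0)"

lemma parity_part_add: "parity_part b (f + g) = parity_part b f + parity_part b g"
  and parity_part_diff: "parity_part b (f - g) = parity_part b f - parity_part b g"
  by (auto simp: parity_part_def fps_eq_iff)

lemma parity_part_mult_of_nat: "parity_part b (of_nat k * f) = of_nat k * parity_part b f"
  by (simp add: parity_part_def fps_eq_iff flip: fps_of_nat)

lemma parity_part_X2_mult: "parity_part b (fps_X\<^sup>2 * f) = fps_X\<^sup>2 * parity_part b f"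
  by (auto simp: parity_part_def fps_eq_iff fps_X_power_mult_nth)

text \<open>Even factors commute with the projection onto one parity of degrees, so they can be
  pulled out in the recursion for \<open>chain_words_series odd\<close>.\<close>

lemma parity_part_power_mult:
  "parity_part b ((1 - fps_X\<^sup>2) ^ k * f) = (1 - fps_X\<^sup>2) ^ k * parity_part b f"
  "parity_part b ((1 + fps_X\<^sup>2) ^ k * f) = (1 + fps_X\<^sup>2) ^ k * parity_part b f"
  by (induction k)
    (simp_all add: mult.assoc left_diff_distrib distrib_right parity_part_diff parity_part_add
      parity_part_X2_mult)

lemma parity_part_X_power: "parity_part b (fps_X ^ k) = (if odd k = b then fps_X ^ k else 0)"
  by (auto simp: parity_part_def fps_eq_iff)

definition changes :: "(nat \<Rightarrow> bool) \<Rightarrow> nat \<Rightarrow> nat" where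
  "changes d n = card {i \<in> {1..n}. d (i - 1) \<noteq> d i}"

lemma changes_0: "changes d 0 = 0"
  by (simp add: changes_def)

lemma changes_Suc: "changes d (Suc n) = changes d n + (if d n \<noteq> d (Suc n) then 1 else 0)"
proof -
  have "{i \<in> {1..Suc n}. d (i - 1) \<noteq> d i} =
      (if d n \<noteq> d (Suc n) then {Suc n} else {}) \<union> {i \<in> {1..n}. d (i - 1) \<noteq> d i}"
    by (auto simp: le_Suc_eq)
  then show ?thesis by (simp add: changes_def)
qed

lemma changes_le: "changes d n \<le> n"
  by (induction n) (simp_all add: changes_0 changes_Suc)

text \<open>Ties the parity of the exponent of X to the current direction.\<close>

lemma odd_changes_iff: "odd (changes d n) \<longleftrightarrow> d 0 \<noteq> d n"
  by (induction n) (auto simp: changes_0 changes_Suc)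

text \<open>
  The coefficient of the left-hand side at \<open>m\<close> counts the words with last letter \<open>m\<close>. Depending on
  the parity of \<open>m\<close>, what precedes it is a word over \<open>{1..m}\<close> or over \<open>{1..m - 1}\<close>.
\<close>

lemma chain_words_series_odd_step:
  assumes "1 \<le> n"
  shows "(1 - fps_X) * chain_words_series odd d (Suc n) =
    (1 + fps_X) * parity_part (d n) (chain_words_series odd d n)"
proof (rule fps_ext)
  fix m
  have "chain_words_series odd d n $ 0 = (0 :: 'a)"
    using card_chain_words_empty[of odd d "n - 1"] assms by (simp add: chain_words_series_def)
  then show "((1 - fps_X :: 'a fps) * chain_words_series odd d (Suc n)) $ m =
    ((1 + fps_X) * parity_part (d n) (chain_words_series odd d n)) $ m"
    using chain_words_series_Suc_nth[OF assms, of odd d, where 'a = 'a]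
    by (cases m) (auto simp: parity_part_def distrib_right)
qed

lemma one_minus_X2: "1 - fps_X\<^sup>2 = (1 - fps_X) * (1 + fps_X :: 'a::comm_ring_1 fps)"
  by (simp add: power2_eq_square algebra_simps)

text \<open>Exhibits both parities of (1 + X)^2 X^(c+1): the middle term against the two outer ones.
  Here \<open>k\<close> will be a power of 2 and \<open>z\<close> an even series.\<close>

lemma one_plus_square_mult_power:
  fixes x k z :: "'a::comm_ring_1"
  shows "(1 + x)\<^sup>2 * (x * (k * x ^ c) * z) =
    z * (k * (x ^ (c + 1) + of_nat 2 * x ^ (c + 2) + x ^ (c + 3)))"
proof -
  have "x ^ (c + 1) = x * x ^ c" "x ^ (c + 2) = x * (x * x ^ c)"
      "x ^ (c + 3) = x * (x * (x * x ^ c))"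
    by (simp_all add: numeral_3_eq_3)
  then show ?thesis by (simp add: power2_eq_square algebra_simps)
qed

text \<open>By \<open>odd_changes_iff\<close> and \<open>d 0\<close>, the degree c + 1 has the
  parity belonging to the direction \<open>d n\<close>. So \<open>parity_part (d (Suc n))\<close>
  keeps the outer terms if the direction stays and the middle term if it changes.\<close>

lemma chain_words_series_odd:
  assumes "d 0"
  shows "(1 - fps_X\<^sup>2) ^ (n + 2) * chain_words_series odd d (Suc n) =
    (1 + fps_X)\<^sup>2 * (fps_X * (2 * fps_X) ^ changes d n * (1 + fps_X\<^sup>2) ^ (n - changes d n))"
proof (induction n)
  case 0
  have "(1 - fps_X\<^sup>2) ^ 2 * chain_words_series odd d (Suc 0) =
      (1 + fps_X)\<^sup>2 * ((1 - fps_X)\<^sup>2 * chain_words_series odd d (Suc 0) :: 'a fps)"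
    unfolding one_minus_X2 by (simp only: power_mult_distrib mult_ac)
  then show ?case
    unfolding chain_words_series_1 changes_0
    by (simp only: add_0 power_0 mult_1_right diff_self_eq_0)
next
  case (Suc n)
  let ?u = "chain_words_series odd d :: nat \<Rightarrow> 'a fps"
  let ?X = "fps_X :: 'a fps"
  define c where "c = changes d n"
  define b where "b = d (Suc n)"
  have two: "(2 * ?X) ^ c = of_nat (2 ^ c) * ?X ^ c" by (simp add: power_mult_distrib)
  have "(1 - ?X\<^sup>2) ^ (Suc n + 2) * ?u (Suc (Suc n)) =
      (1 - ?X\<^sup>2) ^ (n + 2) * (1 + ?X) * ((1 - ?X) * ?u (Suc (Suc n)))"
    by (simp only: one_minus_X2 power_Suc add_Suc mult_ac)
  also have "\<dots> = (1 + ?X)\<^sup>2 * ((1 - ?X\<^sup>2) ^ (n + 2) * parity_part b (?u (Suc n)))"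
  proof -
    have "(1 - ?X) * ?u (Suc (Suc n)) = (1 + ?X) * parity_part b (?u (Suc n))"
      unfolding b_def by (rule chain_words_series_odd_step) simp
    then show ?thesis by (simp only: power2_eq_square mult_ac)
  qed
  also have "(1 - ?X\<^sup>2) ^ (n + 2) * parity_part b (?u (Suc n)) =
      parity_part b ((1 + ?X)\<^sup>2 * (?X * (2 * ?X) ^ c * (1 + ?X\<^sup>2) ^ (n - c)))"
    unfolding parity_part_power_mult(1)[symmetric] Suc.IH c_def ..
  also have "(1 + ?X)\<^sup>2 * (?X * (2 * ?X) ^ c * (1 + ?X\<^sup>2) ^ (n - c)) =
      (1 + ?X\<^sup>2) ^ (n - c) * (of_nat (2 ^ c) * (?X ^ (c + 1) + of_nat 2 * ?X ^ (c + 2) + ?X ^ (c + 3)))"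
    unfolding two by (rule one_plus_square_mult_power)
  also have "parity_part b \<dots> =
      (1 + ?X\<^sup>2) ^ (n - c) * (of_nat (2 ^ c) * (if odd c = b then of_nat 2 * ?X ^ (c + 2)
        else ?X ^ (c + 1) * (1 + ?X\<^sup>2)))"
  proof -
    have "c + 3 = c + 1 + 2" by simp
    then have "?X ^ (c + 1) * (1 + ?X\<^sup>2) = ?X ^ (c + 1) + ?X ^ (c + 3)"
      by (simp only: distrib_left mult_1_right power_add)
    then have "parity_part b (?X ^ (c + 1) + of_nat 2 * ?X ^ (c + 2) + ?X ^ (c + 3)) =
        (if odd c = b then of_nat 2 * ?X ^ (c + 2) else ?X ^ (c + 1) * (1 + ?X\<^sup>2))"
      unfolding parity_part_add parity_part_mult_of_nat parity_part_X_power
      by (cases b; cases "odd c") simp_all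
    then show ?thesis
      by (simp only: parity_part_power_mult parity_part_mult_of_nat)
  qed
  also have "\<dots> = ?X * (2 * ?X) ^ changes d (Suc n) * (1 + ?X\<^sup>2) ^ (Suc n - changes d (Suc n))"
  proof (cases "d n = d (Suc n)")
    case True
    then have "odd c \<noteq> b" using odd_changes_iff[of d n] assms by (auto simp: c_def b_def)
    moreover have "Suc n - changes d (Suc n) = Suc (n - c)" "changes d (Suc n) = c"
      using True changes_le[of d n] by (auto simp: c_def changes_Suc)
    ultimately show ?thesis
      by (simp only: if_False power_mult_distrib of_nat_power of_nat_numeral power_Suc Suc_eq_plus1[symmetric] mult_ac)
  next
    case False
    then have "odd c = b" using odd_changes_iff[of d n] assms by (auto simp: c_def b_def)
    moreover have "Suc n - changes d (Suc n) = n - c" "changes d (Suc n) = Suc c"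
      using False by (auto simp: c_def changes_Suc)
    ultimately show ?thesis
      by (simp only: if_True simp_thms power_mult_distrib of_nat_power of_nat_numeral power_Suc add_2_eq_Suc' mult_ac)
  qed
  finally show ?case .
qed

section \<open>Alphabets of even size and peaks\<close>

definition even_series :: "'a::comm_ring_1 fps \<Rightarrow> 'a fps" where
  "even_series f = Abs_fps (\<lambda>j. f $ (2 * j))"

lemma even_series_add: "even_series (f + g) = even_series f + even_series g"
  and even_series_diff: "even_series (f - g) = even_series f - even_series g"
  by (auto simp: even_series_def fps_eq_iff)

lemma even_series_mult_of_nat: "even_series (of_nat k * f) = of_nat k * even_series f"
  by (simp add: even_series_def fps_eq_iff flip: fps_of_nat)

lemma even_series_X2_mult: "even_series (fps_X\<^sup>2 * f) = fps_X * even_series f"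
proof (rule fps_ext)
  fix j show "even_series (fps_X\<^sup>2 * f) $ j = (fps_X * even_series f) $ j"
    by (cases j) (simp_all add: even_series_def fps_X_power_mult_nth)
qed

lemma even_series_power_mult:
  "even_series ((1 - fps_X\<^sup>2) ^ k * f) = (1 - fps_X) ^ k * even_series f"
  "even_series ((1 + fps_X\<^sup>2) ^ k * f) = (1 + fps_X) ^ k * even_series f"
  by (induction k)
    (simp_all add: mult.assoc left_diff_distrib distrib_right even_series_diff even_series_add
      even_series_X2_mult)

lemma even_series_X_power:
  "even_series (fps_X ^ (2 * k)) = fps_X ^ k" "even_series (fps_X ^ Suc (2 * k)) = 0"
  by (auto simp: even_series_def fps_eq_iff) presburger

lemma chain_words_even_conv_odd: "chain_words even d L n = chain_words odd (\<lambda>i. \<not> d i) L n"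
  by (auto simp: chain_words_def)

lemma changes_not: "changes (\<lambda>i. \<not> d i) n = changes d n"
  by (simp add: changes_def)

text \<open>Exchanging the parities negates \<open>d\<close>, which reduces this to
  \<open>chain_words_series_odd\<close>; then only even degrees are kept and X^2 is renamed X.
  Depending on the parity of the number of changes, the middle or the two outer terms of
  \<open>one_plus_square_mult_power\<close> survive.\<close>

lemma chain_words_series_even:
  assumes "\<not> d 0"
  shows "(1 - fps_X) ^ (n + 2) * Abs_fps (\<lambda>j. of_nat (card (chain_words even d {1..2 * j} (Suc n)))) =
    2 * 4 ^ (changes d n div 2) * fps_X ^ (changes d n div 2 + 1) *
      (1 + fps_X :: 'a::comm_ring_1 fps) ^ (n - 2 * (changes d n div 2))"
proof -
  let ?X = "fps_X :: 'a fps"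
  let ?d = "\<lambda>i. \<not> d i"
  define c where "c = changes d n"
  define q where "q = c div 2"
  have "of_nat (2 ^ (2 * q)) = (of_nat (4 ^ q) :: 'a fps)"
    by (simp only: power_mult) simp
  then have four: "2 ^ (2 * q) = (4 ^ q :: 'a fps)" by simp
  have two: "(2 * ?X) ^ c = of_nat (2 ^ c) * ?X ^ c" by (simp add: power_mult_distrib)
  have "Abs_fps (\<lambda>j. of_nat (card (chain_words even d {1..2 * j} (Suc n))) :: 'a) =
      even_series (chain_words_series odd ?d (Suc n))"
    by (simp add: even_series_def chain_words_series_def chain_words_even_conv_odd)
  then have "(1 - ?X) ^ (n + 2) *
      Abs_fps (\<lambda>j. of_nat (card (chain_words even d {1..2 * j} (Suc n)))) =
      even_series ((1 - ?X\<^sup>2) ^ (n + 2) * chain_words_series odd ?d (Suc n))"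
    by (simp only: even_series_power_mult(1))
  also have "(1 - ?X\<^sup>2) ^ (n + 2) * chain_words_series odd ?d (Suc n) =
      (1 + ?X)\<^sup>2 * (?X * (2 * ?X) ^ c * (1 + ?X\<^sup>2) ^ (n - c))"
    using chain_words_series_odd[of ?d n, where 'a = 'a, OF assms] by (simp only: c_def changes_not)
  also have "(1 + ?X)\<^sup>2 * (?X * (2 * ?X) ^ c * (1 + ?X\<^sup>2) ^ (n - c)) =
      (1 + ?X\<^sup>2) ^ (n - c) * (of_nat (2 ^ c) * (?X ^ (c + 1) + of_nat 2 * ?X ^ (c + 2) + ?X ^ (c + 3)))"
    unfolding two by (rule one_plus_square_mult_power)
  also have "even_series \<dots> = (1 + ?X) ^ (n - c) * (of_nat (2 ^ c) *
      (even_series (?X ^ (c + 1)) + of_nat 2 * even_series (?X ^ (c + 2)) + even_series (?X ^ (c + 3))))"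
    by (simp only: even_series_power_mult even_series_mult_of_nat even_series_add)
  also have "\<dots> = 2 * 4 ^ q * ?X ^ (q + 1) * (1 + ?X) ^ (n - 2 * q)"
  proof (cases "even c")
    case True
    then have c: "c = 2 * q" by (simp add: q_def)
    have e: "c + 1 = Suc (2 * q)" "c + 2 = 2 * (q + 1)" "c + 3 = Suc (2 * (q + 1))" using c by auto
    have "of_nat (2 ^ c) = (4 ^ q :: 'a fps)"
      using four by (simp add: c)
    then show ?thesis unfolding e even_series_X_power
      by (simp only: c add_0_left add_0_right of_nat_numeral mult_ac)
  next
    case False
    then have c: "c = Suc (2 * q)" by (simp add: q_def)
    have e: "c + 1 = 2 * (q + 1)" "c + 2 = Suc (2 * (q + 1))" "c + 3 = 2 * (q + 2)" using c by auto
    \<comment> \<open>The two outer terms yield an extra factor 1 + X, which makes up for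
      \<open>n - c\<close> being one less than \<open>n - 2 * q\<close>.\<close>
    have "n - 2 * q = Suc (n - c)" using changes_le[of d n] c by (simp add: c_def)
    moreover have "of_nat (2 ^ c) = (2 * 4 ^ q :: 'a fps)"
      using four by (simp add: c)
    moreover have "?X ^ (q + 1) + of_nat 2 * 0 + ?X ^ (q + 2) = ?X ^ (q + 1) * (1 + ?X)"
      by (simp add: distrib_left mult.commute)
    ultimately show ?thesis unfolding e even_series_X_power
      by (simp only: power_Suc mult_ac)
  qed
  finally show ?thesis by (simp add: q_def c_def)
qed

text \<open>Starting from a descent, changes alternate between valleys and peaks, so every second
  one is a peak.\<close>

lemma peaks_eq_changes:
  assumes "\<not> d 0"
  shows "card {i \<in> {1..n}. d (i - 1) \<and> \<not> d i} = changes d n div 2"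
proof (induction n)
  case (Suc n)
  have "{i \<in> {1..Suc n}. d (i - 1) \<and> \<not> d i} =
      (if d n \<and> \<not> d (Suc n) then {Suc n} else {}) \<union> {i \<in> {1..n}. d (i - 1) \<and> \<not> d i}"
    by (auto simp: le_Suc_eq)
  then have "card {i \<in> {1..Suc n}. d (i - 1) \<and> \<not> d i} =
      (if d n \<and> \<not> d (Suc n) then 1 else 0) + changes d n div 2"
    using Suc by simp
  then show ?case
    using odd_changes_iff[of d n] assms by (auto simp: changes_Suc elim!: oddE)
qed (simp add: changes_0)

section \<open>Permutations with odd cycles\<close>

text \<open>Over arbitrary sets, because the recursion also removes an element other than the
  largest one.\<close>

definition odd_perms :: "'a set \<Rightarrow> nat \<Rightarrow> ('a \<Rightarrow> 'a) set" where
  "odd_perms S k = {\<pi>. \<pi> permutes S \<and> card (orbit \<pi> ` S) = k \<and>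
     (\<forall>C \<in> orbit \<pi> ` S. odd (card C))}"

lemma odd_cycles_perms_eq: "odd_cycles_perms n k = card (odd_perms {1..n} k)"
  by (simp add: odd_cycles_perms_def odd_perms_def cycle_supports_def)

lemma finite_odd_perms: "finite S \<Longrightarrow> finite (odd_perms S k)"
  by (rule finite_subset[OF _ finite_permutations[of S]]) (auto simp: odd_perms_def)

lemma self_in_orbit: "\<rho> permutes S \<Longrightarrow> finite S \<Longrightarrow> x \<in> orbit \<rho> x"
  by (intro permutation_self_in_orbit) (auto simp: permutation_permutes)

lemma orbit_eq: "\<rho> permutes S \<Longrightarrow> finite S \<Longrightarrow> y \<in> orbit \<rho> x \<Longrightarrow> orbit \<rho> y = orbit \<rho> x"
  by (rule orbit_cyclic_eq3[OF cyclic_on_orbit])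

text \<open>Composing with the transposition inserts \<open>x\<close> into the cycle of \<open>p\<close> right after \<open>p\<close>.\<close>

lemma orbit_insert_element:
  assumes "\<rho> permutes S" "finite S" "x \<notin> S" "p \<in> S"
  defines "\<pi> \<equiv> \<rho> \<circ> transpose p x"
  shows "\<pi> permutes insert x S" "orbit \<pi> p = insert x (orbit \<rho> p)"
    "orbit \<pi> ` insert x S = insert (insert x (orbit \<rho> p)) (orbit \<rho> ` S - {orbit \<rho> p})"
proof -
  show perm: "\<pi> permutes insert x S"
    unfolding \<pi>_def using assms(1,4)
    by (intro permutes_compose permutes_swap_id permutes_subset[OF assms(1)]) auto
  have fin: "finite (insert x S)" using assms by simp
  have \<rho>x: "\<rho> x = x" using assms permutes_not_in by metis
  have \<pi>: "\<pi> p = x" "\<pi> x = \<rho> p" "\<And>y. y \<noteq> p \<Longrightarrow> y \<noteq> x \<Longrightarrow> \<pi> y = \<rho> y"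
    using \<rho>x by (auto simp: \<pi>_def)
  show p: "orbit \<pi> p = insert x (orbit \<rho> p)"
  proof (intro equalityI subsetI)
    fix y assume "y \<in> orbit \<pi> p"
    then show "y \<in> insert x (orbit \<rho> p)"
    proof induction
      case base
      then show ?case by (simp add: \<pi>)
    next
      case (step y)
      then show ?case
        using \<pi> orbit.base[of \<rho> p] orbit.step[of y \<rho> p] by (cases "y = p"; cases "y = x") auto
    qed
  next
    have x: "x \<in> orbit \<pi> p" using orbit.base[of \<pi> p] \<pi> by simp
    have \<rho>p: "\<rho> p \<in> orbit \<pi> p" using orbit.step[OF x] \<pi> by simp
    fix y assume "y \<in> insert x (orbit \<rho> p)"
    then have "y = x \<or> y \<in> orbit \<rho> p" by simp
    then show "y \<in> orbit \<pi> p"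
    proof
      assume "y \<in> orbit \<rho> p"
      then show ?thesis
      proof induction
        case (step y)
        then show ?case
          using \<pi> \<rho>p \<rho>x orbit.step[OF step.IH] by (cases "y = p"; cases "y = x") auto
      qed (rule \<rho>p)
    qed (simp add: x)
  qed
  have other: "orbit \<pi> i = orbit \<rho> i" if "i \<in> S" "i \<notin> orbit \<rho> p" for i
  proof (rule orbit_cong)
    show "i \<in> orbit \<rho> i" by (rule self_in_orbit[OF assms(1,2)])
    fix y assume y: "y \<in> orbit \<rho> i"
    have "y \<in> S" using permutes_orbit_subset[OF assms(1) that(1)] y by blast
    moreover have "y \<noteq> p"
      using y that(2) orbit_eq[OF assms(1,2) y] self_in_orbit[OF assms(1,2), of i] by auto
    ultimately show "\<pi> y = \<rho> y" using \<pi>(3) assms(3) by blast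
  qed
  have same: "orbit \<pi> i = insert x (orbit \<rho> p)" if "i \<in> insert x (orbit \<rho> p)" for i
    using orbit_eq[OF perm fin, of i p] that unfolding p by blast
  have sub: "orbit \<rho> p \<subseteq> S" by (rule permutes_orbit_subset[OF assms(1,4)])
  show "orbit \<pi> ` insert x S = insert (insert x (orbit \<rho> p)) (orbit \<rho> ` S - {orbit \<rho> p})"
  proof (intro equalityI subsetI)
    fix C assume "C \<in> orbit \<pi> ` insert x S"
    then obtain i where i: "C = orbit \<pi> i" "i \<in> insert x S" by blast
    show "C \<in> insert (insert x (orbit \<rho> p)) (orbit \<rho> ` S - {orbit \<rho> p})"
    proof (cases "i \<in> insert x (orbit \<rho> p)")
      case True
      then show ?thesis using same i by blast
    next
      case False
      then have "i \<in> S" "i \<notin> orbit \<rho> p" using i by auto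
      then show ?thesis
        using other i self_in_orbit[OF assms(1,2), of i] by auto
    qed
  next
    fix C assume "C \<in> insert (insert x (orbit \<rho> p)) (orbit \<rho> ` S - {orbit \<rho> p})"
    then consider "C = insert x (orbit \<rho> p)" | i where "C = orbit \<rho> i" "i \<in> S" "orbit \<rho> i \<noteq> orbit \<rho> p"
      by blast
    then show "C \<in> orbit \<pi> ` insert x S"
    proof cases
      case 1
      then show ?thesis using same[of x] by auto
    next
      case 2
      then have "i \<notin> orbit \<rho> p" using orbit_eq[OF assms(1,2)] by blast
      then show ?thesis using other[of i] 2 by auto
    qed
  qed
qed

text \<open>The composition maps p to x, x to a and a to \<rho>(p): both new elements enter the
  cycle of p. The number of cycles stays the same and one length grows by 2, so all parities are
  preserved.\<close>

lemma orbit_insert_two_elements: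
  assumes \<rho>: "\<rho> permutes S" and S: "finite S" "a \<notin> S" "x \<notin> insert a S" "p \<in> S"
  defines "\<pi> \<equiv> \<rho> \<circ> transpose p a \<circ> transpose p x"
  shows "\<pi> permutes insert x (insert a S)"
    "\<pi> \<in> odd_perms (insert x (insert a S)) k \<longleftrightarrow> \<rho> \<in> odd_perms S k"
proof -
  let ?O = "orbit \<rho> p"
  note one = orbit_insert_element[OF \<rho> S(1,2,4)]
  have p: "p \<in> insert a S" using S(4) by simp
  have fin: "finite (insert a S)" using S(1) by simp
  note two = orbit_insert_element[OF one(1) fin S(3) p]
  show perm: "\<pi> permutes insert x (insert a S)"
    using two(1) by (simp add: \<pi>_def)
  have sub: "C \<subseteq> S" if "C \<in> orbit \<rho> ` S" for C
    using that permutes_orbit_subset[OF \<rho>] by blast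
  have O: "?O \<in> orbit \<rho> ` S" using S(4) by blast
  have "insert a ?O \<notin> orbit \<rho> ` S" using sub S(2) by blast
  then have cyc: "orbit \<pi> ` insert x (insert a S) = insert (insert x (insert a ?O)) (orbit \<rho> ` S - {?O})"
    using two(3) unfolding one(2,3) \<pi>_def by blast
  have new: "insert x (insert a ?O) \<notin> orbit \<rho> ` S" using sub S(2) by blast
  then have "card (orbit \<pi> ` insert x (insert a S)) = card (orbit \<rho> ` S)"
    unfolding cyc using O S(1) by (simp add: card.insert_remove card_Suc_Diff1 del: card_Diff_insert)
  moreover have "finite ?O" using sub[OF O] S(1) finite_subset by blast
  then have "card (insert x (insert a ?O)) = card ?O + 2"
    using sub[OF O] S(2,3) by (subst card_insert_disjoint; auto)+
  then have "(\<forall>C \<in> orbit \<pi> ` insert x (insert a S). odd (card C)) \<longleftrightarrow> (\<forall>C \<in> orbit \<rho> ` S. odd (card C))"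
    unfolding cyc using O by (auto simp del: card_insert_disjoint)
  ultimately show "\<pi> \<in> odd_perms (insert x (insert a S)) k \<longleftrightarrow> \<rho> \<in> odd_perms S k"
    using perm \<rho> by (simp add: odd_perms_def)
qed

lemma permutes_insert_fixed: "\<pi> permutes insert x S \<and> \<pi> x = x \<longleftrightarrow> \<pi> permutes S" if "x \<notin> S"
  using that by (metis insert_iff permutes_not_in permutes_superset permutes_subset subset_insertI Diff_iff)

lemma odd_perms_fixed:
  assumes "finite S" "x \<notin> S"
  shows "{\<pi> \<in> odd_perms (insert x S) k. \<pi> x = x} = (if k = 0 then {} else odd_perms S (k - 1))"
proof -
  have "\<pi> \<in> odd_perms (insert x S) k \<longleftrightarrow> 0 < k \<and> \<pi> \<in> odd_perms S (k - 1)" if "\<pi> permutes S" for \<pi>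
  proof -
    have x: "orbit \<pi> x = {x}"
      using orbit_eq_singleton_iff permutes_not_in[OF that assms(2)] by metis
    then have "orbit \<pi> ` insert x S = insert {x} (orbit \<pi> ` S)" by simp
    moreover have "{x} \<notin> orbit \<pi> ` S"
      using permutes_orbit_subset[OF that] assms(2) by blast
    ultimately show ?thesis
      using assms permutes_subset[OF that, of "insert x S"] that by (auto simp: odd_perms_def x)
  qed
  moreover have "\<pi> \<in> odd_perms T j \<Longrightarrow> \<pi> permutes T" for \<pi> T j
    by (simp add: odd_perms_def)
  ultimately have "\<pi> \<in> odd_perms (insert x S) k \<and> \<pi> x = x \<longleftrightarrow> 0 < k \<and> \<pi> \<in> odd_perms S (k - 1)" for \<pi>
    using permutes_insert_fixed[OF assms(2)] by metis
  then show ?thesis by auto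
qed

text \<open>A moved x lies on an odd cycle of length at least 3, so its image a and its preimage p
  differ. Removing x and a from the cycle is inverse to \<open>orbit_insert_two_elements\<close>;
  the factor \<open>card (S - {a})\<close> counts the choices of p.\<close>

lemma card_odd_perms_moved:
  assumes "finite S" "x \<notin> S"
  shows "card {\<pi> \<in> odd_perms (insert x S) k. \<pi> x \<noteq> x} =
    (\<Sum>a\<in>S. card (S - {a}) * card (odd_perms (S - {a}) k))"
proof -
  let ?T = "SIGMA a:S. (S - {a}) \<times> odd_perms (S - {a}) k"
  let ?B = "{\<pi> \<in> odd_perms (insert x S) k. \<pi> x \<noteq> x}"
  let ?g = "\<lambda>\<pi>. (\<pi> x, inv \<pi> x, \<pi> \<circ> transpose (inv \<pi> x) x \<circ> transpose (inv \<pi> x) (\<pi> x))"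
  let ?f = "\<lambda>(a, p, \<rho>). \<rho> \<circ> transpose p a \<circ> transpose p x"
  have swap: "f \<circ> transpose u v \<circ> transpose u v = f" for f :: "'a \<Rightarrow> 'a" and u v
    by (simp add: fun_eq_iff)
  have "bij_betw ?f ?T ?B"
  proof (rule bij_betwI[where g = ?g])
    have f: "?f (a, p, \<rho>) \<in> ?B \<and> ?g (?f (a, p, \<rho>)) = (a, p, \<rho>)"
      if "a \<in> S" "p \<in> S - {a}" "\<rho> \<in> odd_perms (S - {a}) k" for a p \<rho>
    proof -
      define \<pi> where "\<pi> = \<rho> \<circ> transpose p a \<circ> transpose p x"
      have \<rho>: "\<rho> permutes S - {a}" using that by (simp add: odd_perms_def)
      have ins: "insert a (S - {a}) = S" using that by blast
      have \<pi>: "\<pi> permutes insert x S" "\<pi> \<in> odd_perms (insert x S) k"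
        using orbit_insert_two_elements(1)[OF \<rho>, of a x p]
          orbit_insert_two_elements(2)[OF \<rho>, of a x p k] assms that
        unfolding ins \<pi>_def by auto
      have "\<rho> a = a" "\<rho> x = x"
        using permutes_not_in[OF \<rho>] assms(2) by auto
      then have "\<pi> x = a" "\<pi> p = x"
        using that assms(2) by (auto simp: \<pi>_def transpose_def)
      moreover from this have "inv \<pi> x = p"
        using permutes_inv_eq[OF \<pi>(1)] by blast
      ultimately show ?thesis
        using \<pi> that assms(2) by (auto simp: \<pi>_def swap)
    qed
    then show "?f \<in> ?T \<rightarrow> ?B" by auto
    show "?g (?f t) = t" if t: "t \<in> ?T" for t
    proof (cases t)
      case (fields a p \<rho>)
      then show ?thesis using t f[of a p \<rho>] by blast
    qed
    have g: "?g \<pi> \<in> ?T \<and> ?f (?g \<pi>) = \<pi>" if B: "\<pi> \<in> ?B" for \<pi>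
    proof -
      define a p where "a = \<pi> x" and "p = inv \<pi> x"
      define \<rho> where "\<rho> = \<pi> \<circ> transpose p x \<circ> transpose p a"
      have \<pi>: "\<pi> permutes insert x S" using B by (simp add: odd_perms_def)
      have fin: "finite (insert x S)" using assms by simp
      have "\<pi> p = x" by (simp add: p_def permutes_inverses[OF \<pi>])
      have "a \<in> S" using B permutes_in_image[OF \<pi>, of x] by (auto simp: a_def)
      have "p \<noteq> x" using \<open>\<pi> p = x\<close> B by auto
      then have "p \<in> S"
        using \<open>\<pi> p = x\<close> permutes_in_image[OF \<pi>, of p] by auto
      \<comment> \<open>Otherwise x and a would form a cycle of length 2, which is even.\<close>
      have "p \<noteq> a"
      proof
        assume "p = a"
        then have "\<pi> a = x" using \<open>\<pi> p = x\<close> by simp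
        have "a \<in> orbit \<pi> x" unfolding a_def by (rule orbit.base)
        moreover from this have "x \<in> orbit \<pi> x" using orbit.step \<open>\<pi> a = x\<close> by metis
        moreover have "y \<in> {x, a}" if "y \<in> orbit \<pi> x" for y
          using that by induction (auto simp: \<open>\<pi> a = x\<close> a_def[symmetric])
        ultimately have "orbit \<pi> x = {x, a}" by blast
        then have "card (orbit \<pi> x) = 2" using B by (auto simp: a_def)
        then show False using B by (auto simp: odd_perms_def)
      qed
      have ins: "insert x (insert a (S - {a})) = insert x S" using \<open>a \<in> S\<close> by blast
      have "\<rho> permutes insert x S"
        unfolding \<rho>_def using \<open>a \<in> S\<close> \<open>p \<in> S\<close> \<pi>
        by (intro permutes_compose[OF permutes_swap_id] permutes_compose[OF permutes_swap_id]) auto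
      moreover have "\<rho> x = x" "\<rho> a = a"
      proof -
        have "x \<noteq> a" using \<open>a \<in> S\<close> assms(2) by blast
        then have "transpose p a x = x" using \<open>p \<noteq> x\<close> by (simp add: transpose_def)
        then show "\<rho> x = x" using \<open>\<pi> p = x\<close> by (simp add: \<rho>_def)
        show "\<rho> a = a" by (simp add: \<rho>_def) (simp add: a_def)
      qed
      ultimately have \<rho>: "\<rho> permutes S - {a}"
        by (elim permutes_superset) blast
      have comp_eq: "\<rho> \<circ> transpose p a \<circ> transpose p x = \<pi>"
        by (simp add: \<rho>_def swap)
      have "\<rho> \<in> odd_perms (S - {a}) k"
        using orbit_insert_two_elements(2)[OF \<rho>, of a x p k] assms \<open>p \<in> S\<close> \<open>p \<noteq> a\<close> \<open>a \<in> S\<close> B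
        unfolding ins comp_eq by auto
      then have "(a, p, \<rho>) \<in> ?T \<and> ?f (a, p, \<rho>) = \<pi>"
        using \<open>a \<in> S\<close> \<open>p \<in> S\<close> \<open>p \<noteq> a\<close> comp_eq by simp
      moreover have "?g \<pi> = (a, p, \<rho>)" unfolding a_def p_def \<rho>_def ..
      ultimately show ?thesis by (simp only:)
    qed
    then show "?g \<in> ?B \<rightarrow> ?T" by blast
    show "?f (?g \<pi>) = \<pi>" if "\<pi> \<in> ?B" for \<pi> using g that by blast
  qed
  then have "card ?B = card ?T" by (simp add: bij_betw_same_card)
  also have "\<dots> = (\<Sum>a\<in>S. card (S - {a}) * card (odd_perms (S - {a}) k))"
    using assms(1) by (simp add: card_SigmaI finite_odd_perms card_cartesian_product)
  finally show ?thesis .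
qed

text \<open>
  Either the largest element is a fixed point, or it is inserted together with its successor into
  an odd cycle of a permutation of two elements less.
\<close>

fun odd_cycle_number :: "nat \<Rightarrow> nat \<Rightarrow> nat" where
  "odd_cycle_number 0 k = (if k = 0 then 1 else 0)"
| "odd_cycle_number (Suc 0) k = (if k = 1 then 1 else 0)"
| "odd_cycle_number (Suc (Suc n)) k = (if k = 0 then 0 else odd_cycle_number (Suc n) (k - 1)) +
     Suc n * (n * odd_cycle_number n k)"

lemma card_odd_perms_insert:
  assumes "finite S" "x \<notin> S"
  shows "card (odd_perms (insert x S) k) = (if k = 0 then 0 else card (odd_perms S (k - 1))) +
    (\<Sum>a\<in>S. card (S - {a}) * card (odd_perms (S - {a}) k))"
proof -
  have "odd_perms (insert x S) k =
      {\<pi> \<in> odd_perms (insert x S) k. \<pi> x = x} \<union> {\<pi> \<in> odd_perms (insert x S) k. \<pi> x \<noteq> x}"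
    by blast
  then have "card (odd_perms (insert x S) k) =
      card {\<pi> \<in> odd_perms (insert x S) k. \<pi> x = x} + card {\<pi> \<in> odd_perms (insert x S) k. \<pi> x \<noteq> x}"
    using assms(1) by (subst card_Un_disjoint[symmetric]) (auto simp: finite_odd_perms)
  then show ?thesis
    unfolding odd_perms_fixed[OF assms] card_odd_perms_moved[OF assms] by simp
qed

lemma odd_perms_empty: "odd_perms {} k = (if k = 0 then {id} else {})"
  by (auto simp: odd_perms_def)

lemma card_odd_perms: "finite S \<Longrightarrow> card (odd_perms S k) = odd_cycle_number (card S) k"
proof (induction "card S" k arbitrary: S rule: odd_cycle_number.induct)
  case (1 k)
  then show ?case by (simp add: odd_perms_empty)
next
  case (2 k)
  then obtain x where S: "S = {x}" by (metis One_nat_def card_1_singletonE)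
  show ?case
    using card_odd_perms_insert[of "{}" x k] by (simp add: S odd_perms_empty)
next
  case (3 n k)
  then obtain x T where S: "S = insert x T" "x \<notin> T" "card T = Suc n"
    by (metis card_Suc_eq)
  then have "finite T" using 3 by simp
  have "card (odd_perms (T - {a}) k) = odd_cycle_number n k" if "a \<in> T" for a
    using 3(2)[of "T - {a}"] S \<open>finite T\<close> that by simp
  then have "card (odd_perms S k) = (if k = 0 then 0 else odd_cycle_number (Suc n) (k - 1)) +
      (\<Sum>a\<in>T. n * odd_cycle_number n k)"
    unfolding S(1) card_odd_perms_insert[OF \<open>finite T\<close> S(2)]
    using 3(1)[of T] S \<open>finite T\<close> by (intro arg_cong2[of _ _ _ _ "(+)"] sum.cong) auto
  then show ?case using S \<open>finite T\<close> by simp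
qed

lemma odd_cycles_perms_eq_odd_cycle_number: "odd_cycles_perms n k = odd_cycle_number n k"
  by (simp add: odd_cycles_perms_eq card_odd_perms)

text \<open>Ensures that \<open>(n - k) div 2\<close> is an exact half wherever the coefficient is
  nonzero.\<close>

lemma odd_cycle_number_nonzero:
  "odd_cycle_number n k \<noteq> 0 \<Longrightarrow> k \<le> n \<and> even (n - k)"
proof (induction n k rule: odd_cycle_number.induct)
  case (3 n k)
  then consider "k \<noteq> 0" "odd_cycle_number (Suc n) (k - 1) \<noteq> 0" | "odd_cycle_number n k \<noteq> 0"
    by (auto split: if_splits)
  then show ?case
  proof cases
    case 1
    then show ?thesis using 3 by (cases k) auto
  next
    case 2
    then show ?thesis using 3 by (auto simp: Suc_diff_le)
  qed
qed (auto split: if_splits)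

lemma odd_cycle_number_Suc_0: "odd_cycle_number (Suc n) 0 = 0"
  by (induction n rule: induct_nat_012) simp_all

lemma odd_cycle_number_sum_Suc:
  fixes y :: "'a::comm_semiring_1"
  defines "e \<equiv> \<lambda>n. \<Sum>k\<le>n. of_nat (odd_cycle_number n k) * y ^ k"
  shows "e (Suc (Suc n)) = y * e (Suc n) + of_nat (Suc n * n) * e n"
proof -
  have "e (Suc (Suc n)) =
      (\<Sum>k\<le>Suc (Suc n). of_nat (if k = 0 then 0 else odd_cycle_number (Suc n) (k - 1)) * y ^ k) +
      (\<Sum>k\<le>Suc (Suc n). of_nat (Suc n * n) * (of_nat (odd_cycle_number n k) * y ^ k))"
    unfolding e_def sum.distrib[symmetric]
    by (intro sum.cong) (simp_all add: algebra_simps)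
  also have "(\<Sum>k\<le>Suc (Suc n). of_nat (if k = 0 then 0 else odd_cycle_number (Suc n) (k - 1)) * y ^ k) =
      y * e (Suc n)"
    unfolding e_def sum.atMost_Suc_shift[of _ "Suc n"] sum_distrib_left
    by (simp add: mult_ac)
  also have "(\<Sum>k\<le>Suc (Suc n). of_nat (Suc n * n) * (of_nat (odd_cycle_number n k) * y ^ k)) =
      of_nat (Suc n * n) * e n"
    unfolding e_def sum_distrib_left
  proof (rule sum.mono_neutral_right)
    show "\<forall>k\<in>{..Suc (Suc n)} - {..n}.
        of_nat (Suc n * n) * (of_nat (odd_cycle_number n k) * y ^ k) = 0"
    proof
      fix k assume "k \<in> {..Suc (Suc n)} - {..n}"
      then have "odd_cycle_number n k = 0"
        using odd_cycle_number_nonzero[of n k] by auto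
      then show "of_nat (Suc n * n) * (of_nat (odd_cycle_number n k) * y ^ k) = 0" by simp
    qed
  qed auto
  finally show ?thesis .
qed

text \<open>Y = (1+X)/(1-X) satisfies (1-X^2) Y' = 2 Y, hence F = Y^N satisfies (1-X^2) F' = 2N F.
  Comparing coefficients and multiplying by factorials gives the recurrence of
  \<open>odd_cycle_number_sum_Suc\<close> with y = 2N.\<close>

lemma odd_cycle_number_series:
  "(((1 + fps_X) / (1 - fps_X) :: rat fps) ^ N) $ n * fact n =
    (\<Sum>k\<le>n. of_nat (odd_cycle_number n k) * (2 * of_nat N) ^ k)"
proof -
  define Y where "Y = (1 + fps_X) / (1 - fps_X :: rat fps)"
  define F where "F = Y ^ N"
  have Y: "(1 - fps_X) * Y = 1 + fps_X"
    by (simp add: Y_def fps_divide_unit mult.left_commute inverse_mult_eq_1')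
  have Y0: "Y $ 0 = 1" by (simp add: Y_def fps_divide_unit)
  have "fps_deriv ((1 - fps_X) * Y) = 1" unfolding Y by simp
  then have "(1 - fps_X) * fps_deriv Y = 1 + Y" by (simp add: algebra_simps)
  \<comment> \<open>The additional factor 1 - X allows Y to be eliminated through (1 - X) Y = 1 + X
    and is cancelled afterwards.\<close>
  then have "(1 - fps_X) * ((1 - fps_X\<^sup>2) * fps_deriv Y) = (1 - fps_X\<^sup>2) * (1 + Y)"
    by (subst mult.left_commute) simp
  also have "\<dots> = (1 + fps_X) * ((1 - fps_X) + (1 - fps_X) * Y)"
    by (simp add: algebra_simps power2_eq_square)
  also have "\<dots> = (1 - fps_X) * (2 * Y)"
    unfolding Y mult.left_commute[of "1 - fps_X" 2] by simp
  finally have Y': "(1 - fps_X\<^sup>2) * fps_deriv Y = 2 * Y"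
    by (subst (asm) mult_cancel_left) (auto dest: arg_cong[of _ _ "\<lambda>f. f $ 0"])
  have "(1 - fps_X\<^sup>2) * fps_deriv F = of_nat N * Y ^ (N - 1) * ((1 - fps_X\<^sup>2) * fps_deriv Y)"
    unfolding F_def fps_deriv_power' by (simp only: mult_ac)
  also have "\<dots> = of_nat (2 * N) * F"
    unfolding Y' F_def by (cases N) (simp_all add: algebra_simps)
  finally have F': "(1 - fps_X\<^sup>2) * fps_deriv F = of_nat (2 * N) * F" .
  have rec: "of_nat (Suc (Suc n)) * F $ Suc (Suc n) =
      of_nat (2 * N) * F $ Suc n + of_nat n * F $ n" for n
    using arg_cong[OF F', of "\<lambda>f. f $ Suc n"]
    by (simp add: left_diff_distrib fps_X_power_mult_nth flip: fps_of_nat)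
      (cases n, simp_all add: algebra_simps)
  have F0: "F $ 0 = 1" by (simp add: F_def Y0 fps_nth_power_0)
  have F1: "F $ Suc 0 = 2 * of_nat N"
    using arg_cong[OF F', of "\<lambda>f. f $ 0"] F0 by (simp add: left_diff_distrib flip: fps_of_nat)
  have "F $ n * fact n = (\<Sum>k\<le>n. of_nat (odd_cycle_number n k) * (2 * of_nat N) ^ k)"
  proof (induction n rule: induct_nat_012)
    case (ge2 n)
    have "F $ Suc (Suc n) * fact (Suc (Suc n)) =
        (of_nat (Suc (Suc n)) * F $ Suc (Suc n)) * fact (Suc n)"
      by (simp only: fact_Suc mult_ac)
    also have "\<dots> = 2 * of_nat N * (F $ Suc n * fact (Suc n)) +
        of_nat (Suc n * n) * (F $ n * fact n)"
      unfolding rec by (simp add: algebra_simps)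
    finally show ?case
      unfolding ge2 odd_cycle_number_sum_Suc .
  qed (simp_all add: F0 F1)
  then show ?thesis by (simp add: F_def Y_def)
qed

section \<open>Up-down runs, peaks and descents\<close>

text \<open>
  The direction \<open>b\<close> of the virtual step at position 0 distinguishes up-down runs (\<open>True\<close>) from
  peaks (\<open>False\<close>).
\<close>

definition updown :: "(nat \<Rightarrow> nat) \<Rightarrow> bool \<Rightarrow> nat \<Rightarrow> bool" where
  "updown \<pi> b i = (if i = 0 then b else ascent \<pi> i)"

lemma descent_iff: "inj \<pi> \<Longrightarrow> \<pi> (i + 1) < \<pi> i \<longleftrightarrow> \<not> ascent \<pi> i"
  using injD[of \<pi> i "i + 1"] by (fastforce simp: ascent_def)

text \<open>Monotonicity is a condition on adjacent positions, and injectivity makes every step that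
  is not an ascent a strict descent. For i = j the condition is vacuous.\<close>

lemma monotone_segments_iff:
  assumes "inj \<pi>"
  shows "(i, j) \<in> monotone_segments n \<pi> \<longleftrightarrow>
    1 \<le> i \<and> i \<le> j \<and> j \<le> n \<and> (\<forall>k \<in> {i..<j}. ascent \<pi> k = ascent \<pi> i)"
proof -
  have less: "\<pi> a < \<pi> b" if "\<forall>k \<in> {i..<j}. ascent \<pi> k" "i \<le> a" "a < b" "b \<le> j" for a b
  proof -
    from that(3) have "Suc a \<le> b" by simp
    then show ?thesis using that(4)
    proof (induction b rule: dec_induct)
      case base
      then show ?case using that by (auto simp: ascent_def)
    next
      case (step b)
      then have "\<pi> b < \<pi> (Suc b)" using that(1,2) by (auto simp: ascent_def)
      then show ?case using step by simp
    qed
  qed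
  have greater: "\<pi> a > \<pi> b" if "\<forall>k \<in> {i..<j}. \<not> ascent \<pi> k" "i \<le> a" "a < b" "b \<le> j" for a b
  proof -
    have desc: "\<pi> (Suc k) < \<pi> k" if "k \<in> {i..<j}" for k
      using \<open>\<forall>k \<in> {i..<j}. \<not> ascent \<pi> k\<close> that injD[OF assms, of k "Suc k"]
      by (auto simp: ascent_def not_less le_less)
    from that(3) have "Suc a \<le> b" by simp
    then show ?thesis using that(4)
    proof (induction b rule: dec_induct)
      case base
      then show ?case using that desc[of a] by auto
    next
      case (step b)
      then show ?case using that(2) desc[of b] by auto
    qed
  qed
  have "strict_mono_on {i..j} \<pi> \<longleftrightarrow> (\<forall>k \<in> {i..<j}. ascent \<pi> k)"
    using less by (auto simp: ascent_def monotone_on_def)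
  moreover have "strict_antimono_on {i..j} \<pi> \<longleftrightarrow> (\<forall>k \<in> {i..<j}. \<not> ascent \<pi> k)"
  proof
    assume mono: "strict_antimono_on {i..j} \<pi>"
    show "\<forall>k \<in> {i..<j}. \<not> ascent \<pi> k"
    proof
      fix k assume "k \<in> {i..<j}"
      then have "\<pi> (Suc k) < \<pi> k" using mono by (auto simp: monotone_on_def)
      then show "\<not> ascent \<pi> k" by (simp add: ascent_def)
    qed
  qed (use greater in \<open>auto simp: monotone_on_def\<close>)
  moreover have "(\<forall>k \<in> {i..<j}. P k) \<or> (\<forall>k \<in> {i..<j}. \<not> P k) \<longleftrightarrow> (\<forall>k \<in> {i..<j}. P k = P i)"
    for P by (cases "P i") (metis atLeastLessThan_iff le_refl order.strict_trans1)+
  ultimately show ?thesis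
    unfolding monotone_segments_def by blast
qed

text \<open>A birun is determined by its first position, which is 1 or a position where the
  direction changes; consecutive biruns share an endpoint. For \<open>2 \<le> n\<close> no birun
  consists of a single position.\<close>

lemma card_biruns:
  assumes "inj \<pi>" "2 \<le> n"
  shows "card (biruns n \<pi>) = Suc (card {i \<in> {2..n - 1}. ascent \<pi> (i - 1) \<noteq> ascent \<pi> i})"
proof -
  note seg = monotone_segments_iff[OF assms(1)]
  let ?T = "{i \<in> {2..n - 1}. ascent \<pi> (i - 1) \<noteq> ascent \<pi> i}"
  have max: "(i', j') = (i, j)"
    if "(i, j) \<in> biruns n \<pi>" "(i', j') \<in> monotone_segments n \<pi>" "i' \<le> i" "j \<le> j'" for i j i' j'
  proof -
    have "{i..j} \<subseteq> {i'..j'}" using that(3,4) by auto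
    then show ?thesis using that(1,2) unfolding biruns_def by blast
  qed
  have segI: "(i, j) \<in> monotone_segments n \<pi>" if "(i, j) \<in> biruns n \<pi>" for i j
    using that by (simp add: biruns_def)
  have short: "(i, Suc i) \<in> monotone_segments n \<pi>" if "1 \<le> i" "i < n" for i
    using that by (auto simp: seg less_Suc_eq_le le_antisym)
  have "inj_on fst (biruns n \<pi>)"
  proof (rule inj_onI, clarsimp)
    fix i j j' assume "(i, j) \<in> biruns n \<pi>" "(i, j') \<in> biruns n \<pi>"
    then show "j = j'"
      using max[of i j i j'] max[of i j' i j] segI by (cases "j \<le> j'") auto
  qed
  moreover have "fst ` biruns n \<pi> = insert 1 ?T"
  proof (intro equalityI subsetI)
    fix i assume "i \<in> fst ` biruns n \<pi>"
    then obtain j where b: "(i, j) \<in> biruns n \<pi>" by auto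
    note s = segI[OF b, unfolded seg]
    have "i \<noteq> n"
    proof
      assume "i = n"
      then have "(n - 1, n) \<in> monotone_segments n \<pi>" using short[of "n - 1"] assms(2) by simp
      then show False using max[OF b, of "n - 1" n] s \<open>i = n\<close> assms(2) by auto
    qed
    then have i: "1 \<le> i" "i < n" using s by auto
    have "j \<noteq> i"
    proof
      assume "j = i"
      have "(i, Suc i) \<in> monotone_segments n \<pi>" using i by (rule short)
      then show False using max[OF b, of i "Suc i"] \<open>j = i\<close> by auto
    qed
    show "i \<in> insert 1 ?T"
    proof (rule ccontr)
      assume "i \<notin> insert 1 ?T"
      then have i2: "2 \<le> i" "ascent \<pi> (i - 1) = ascent \<pi> i" using i by auto
      have "ascent \<pi> k = ascent \<pi> (i - 1)" if "k \<in> {i - 1..<j}" for k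
      proof (cases "k = i - 1")
        case False
        then have "k \<in> {i..<j}" using that by auto
        then show ?thesis using s i2 by blast
      qed simp
      then have "\<forall>k \<in> {i - 1..<j}. ascent \<pi> k = ascent \<pi> (i - 1)" by blast
      moreover have "1 \<le> i - 1" "i - 1 \<le> j" "j \<le> n" using s i2(1) by linarith+
      ultimately have "(i - 1, j) \<in> monotone_segments n \<pi>" unfolding seg by blast
      then show False using max[OF b, of "i - 1" j] i2(1) by auto
    qed
  next
    fix i assume i: "i \<in> insert 1 ?T"
    then have i_bounds: "1 \<le> i" "i < n" using assms(2) by auto
    \<comment> \<open>The birun starting at \<open>i\<close> is the longest monotone segment
      starting there; it cannot be extended to the left, as \<open>i = 1\<close> or the direction
      changes at \<open>i\<close>.\<close>
    define J where "J = {j. (i, j) \<in> monotone_segments n \<pi>}"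
    have "finite J" by (rule finite_subset[of _ "{..n}"]) (auto simp: J_def seg)
    have "Suc i \<in> J" using short[OF i_bounds] by (simp add: J_def)
    define j where "j = Max J"
    have "j \<in> J" using \<open>finite J\<close> \<open>Suc i \<in> J\<close> unfolding j_def by (intro Max_in) auto
    have "Suc i \<le> j" using \<open>finite J\<close> \<open>Suc i \<in> J\<close> unfolding j_def by (rule Max_ge)
    have "(i', j') = (i, j)" if s: "(i', j') \<in> monotone_segments n \<pi>" and sub: "{i..j} \<subseteq> {i'..j'}" for i' j'
    proof -
      have le: "i' \<le> i" "j \<le> j'" using sub \<open>Suc i \<le> j\<close> by auto
      have "i' = i"
      proof (rule ccontr)
        assume "i' \<noteq> i"
        then have "i' < i" using le by simp
        then have "i - 1 \<in> {i'..<j'}" "i \<in> {i'..<j'}" using le \<open>Suc i \<le> j\<close> by auto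
        then have "ascent \<pi> (i - 1) = ascent \<pi> i" using s unfolding seg by blast
        moreover have "i \<noteq> 1" using \<open>i' < i\<close> s by (auto simp: seg)
        ultimately show False using i by auto
      qed
      moreover from this have "j' \<le> j" using s \<open>finite J\<close> unfolding j_def by (auto simp: J_def)
      ultimately show ?thesis using le by simp
    qed
    then have "(i, j) \<in> biruns n \<pi>" using \<open>j \<in> J\<close> by (auto simp: biruns_def J_def)
    then show "i \<in> fst ` biruns n \<pi>" by force
  qed
  ultimately have "card (biruns n \<pi>) = card (insert 1 ?T)" by (metis card_image)
  then show ?thesis by simp
qed

text \<open>The additional one-element run at an initial descent is the change against the virtual
  ascent at position 0; the remaining changes separate the biruns.\<close>

lemma udr_eq_changes:
  assumes "inj \<pi>" "1 \<le> n"
  shows "udr n \<pi> = Suc (changes (updown \<pi> True) (n - 1))"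
proof (cases "n = 1")
  case True
  have "biruns 1 \<pi> = {(1, 1)}"
    by (auto simp: biruns_def monotone_segments_iff[OF assms(1)])
  then show ?thesis by (simp add: udr_def up_down_runs_def True changes_0)
next
  case False
  then have n: "2 \<le> n" using assms(2) by simp
  let ?T = "{i \<in> {2..n - 1}. ascent \<pi> (i - 1) \<noteq> ascent \<pi> i}"
  have "(1, 1) \<notin> biruns n \<pi>"
  proof
    assume "(1, 1) \<in> biruns n \<pi>"
    moreover have "(1, 2) \<in> monotone_segments n \<pi>"
      using n by (auto simp: monotone_segments_iff[OF assms(1)] less_Suc_eq numeral_2_eq_2)
    ultimately show False unfolding biruns_def by fastforce
  qed
  moreover have "card (biruns n \<pi>) = Suc (card ?T)" by (rule card_biruns[OF assms(1) n])
  moreover from this have "finite (biruns n \<pi>)" by (metis card.infinite nat.distinct(1))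
  ultimately have "udr n \<pi> = Suc (card ?T) + (if \<pi> 1 > \<pi> 2 then 1 else 0)"
    using n by (simp add: udr_def up_down_runs_def)
  moreover have "{i \<in> {1..n - 1}. updown \<pi> True (i - 1) \<noteq> updown \<pi> True i} =
      (if \<pi> 1 > \<pi> 2 then {1} else {}) \<union> ?T"
  proof -
    have one: "(updown \<pi> True 0 \<noteq> updown \<pi> True 1) = (\<pi> 1 > \<pi> 2)"
      using descent_iff[OF assms(1), of 1] by (simp add: updown_def numeral_2_eq_2)
    have "(updown \<pi> True (i - 1) \<noteq> updown \<pi> True i) = (ascent \<pi> (i - 1) \<noteq> ascent \<pi> i)"
      if "2 \<le> i" for i using that by (auto simp: updown_def)
    moreover have "{1..n - 1} = insert 1 {2..n - 1}" using n by auto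
    ultimately show ?thesis using one by auto
  qed
  then have "changes (updown \<pi> True) (n - 1) = (if \<pi> 1 > \<pi> 2 then 1 else 0) + card ?T"
    by (simp add: changes_def)
  ultimately show ?thesis by simp
qed

text \<open>The virtual descent at position 0 prevents position 1 from counting as a peak.\<close>

lemma pk_eq:
  assumes "inj \<pi>"
  shows "pk n \<pi> = card {i \<in> {1..n - 1}. updown \<pi> False (i - 1) \<and> \<not> updown \<pi> False i}"
proof -
  have "(\<pi> (i - 1) < \<pi> i \<and> \<pi> i > \<pi> (i + 1)) =
      (updown \<pi> False (i - 1) \<and> \<not> updown \<pi> False i)" if "2 \<le> i" for i
    using that descent_iff[OF assms, of i] by (auto simp: updown_def ascent_def)
  moreover have "\<not> updown \<pi> False (i - 1)" if "\<not> 2 \<le> i" for i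
    using that by (simp add: updown_def)
  ultimately have "i \<in> {2..n - 1} \<and> \<pi> (i - 1) < \<pi> i \<and> \<pi> i > \<pi> (i + 1) \<longleftrightarrow>
      i \<in> {1..n - 1} \<and> updown \<pi> False (i - 1) \<and> \<not> updown \<pi> False i" for i
    by (cases "2 \<le> i") auto
  then show ?thesis by (simp add: pk_def)
qed

lemma des_eq:
  assumes "inj \<pi>"
  shows "des n \<pi> = card {i \<in> {1..n - 1}. \<not> ascent \<pi> i}"
  unfolding des_def descent_iff[OF assms] ..

section \<open>Generating functions of permutation statistics\<close>

text \<open>The statistic polynomials are evaluated in several rings; homomorphisms move identities
  along the embedding of constants, the substitution of X^2, the embedding of series in x and the
  evaluation of polynomials.\<close>

definition is_ring_hom :: "('a::comm_ring_1 \<Rightarrow> 'b::comm_ring_1) \<Rightarrow> bool" where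
  "is_ring_hom h \<longleftrightarrow> h 0 = 0 \<and> h 1 = 1 \<and> (\<forall>a b. h (a + b) = h a + h b) \<and>
     (\<forall>a b. h (a * b) = h a * h b)"

lemma is_ring_homD:
  assumes "is_ring_hom h"
  shows "h 0 = 0" "h 1 = 1" "h (a + b) = h a + h b" "h (a * b) = h a * h b"
  using assms by (simp_all add: is_ring_hom_def)

lemma is_ring_hom_power: "is_ring_hom h \<Longrightarrow> h (a ^ n) = h a ^ n"
  by (induction n) (simp_all add: is_ring_homD)

lemma is_ring_hom_of_nat: "is_ring_hom h \<Longrightarrow> h (of_nat n) = of_nat n"
  by (induction n) (simp_all add: is_ring_homD)

lemma is_ring_hom_diff: "is_ring_hom h \<Longrightarrow> h (a - b) = h a - h b"
  using is_ring_homD(3)[of h "a - b" b] by simp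

lemma is_ring_hom_sum: "is_ring_hom h \<Longrightarrow> h (sum f A) = (\<Sum>a\<in>A. h (f a))"
  by (induction A rule: infinite_finite_induct) (simp_all add: is_ring_homD)

lemma is_ring_hom_fps_const: "is_ring_hom fps_const"
  by (simp add: is_ring_hom_def)

lemma is_ring_hom_eulerian_A: "is_ring_hom h \<Longrightarrow> h (eulerian_A n t) = eulerian_A n (h t)"
  by (simp add: eulerian_A_def is_ring_homD is_ring_hom_sum is_ring_hom_power)

lemma is_ring_hom_P_udr: "is_ring_hom h \<Longrightarrow> h (P_udr n t) = P_udr n (h t)"
  by (simp add: P_udr_def is_ring_homD is_ring_hom_sum is_ring_hom_power)

lemma is_ring_hom_P_pk: "is_ring_hom h \<Longrightarrow> h (P_pk n t) = P_pk n (h t)"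
  by (simp add: P_pk_def is_ring_homD is_ring_hom_sum is_ring_hom_power)

lemma is_ring_hom_P_udr_ipk: "is_ring_hom h \<Longrightarrow> h (P_udr_ipk n s t) = P_udr_ipk n (h s) (h t)"
  by (simp add: P_udr_ipk_def is_ring_homD is_ring_hom_sum is_ring_hom_power)

lemma is_ring_hom_of_int: "is_ring_hom h \<Longrightarrow> h (of_int k) = of_int k"
  by (cases k rule: int_diff_cases) (simp add: is_ring_hom_diff is_ring_hom_of_nat)

lemma is_ring_hom_eulerian_B:
  assumes h: "is_ring_hom h"
  shows "h (eulerian_B n t) = eulerian_B n (h t)"
proof -
  have "h (poly (map_poly of_int p) t) = poly (map_poly of_int p) (h t)" for p
    by (induction p) (simp_all add: map_poly_pCons is_ring_homD[OF h] is_ring_hom_of_int[OF h])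
  then show ?thesis by (simp add: eulerian_B_def)
qed

lemma is_ring_hom_fps_compose: "c $ 0 = (0 :: 'a::idom) \<Longrightarrow> is_ring_hom (\<lambda>f. f oo c)"
  by (simp add: is_ring_hom_def fps_compose_add_distrib fps_compose_mult_distrib)

lemma is_ring_hom_eval_poly:
  fixes h :: "'a::comm_ring_1 \<Rightarrow> 'b::comm_ring_1"
  assumes h: "is_ring_hom h"
  shows "is_ring_hom (\<lambda>p. poly (map_poly h p) x)"
proof -
  let ?e = "\<lambda>p. poly (map_poly h p) x"
  have pCons: "?e (pCons a p) = h a + x * ?e p" for a p
    by (simp add: map_poly_pCons is_ring_homD[OF h])
  have zero: "?e 0 = 0" by simp
  have add: "?e (p + q) = ?e p + ?e q" for p q
    by (induction p q rule: poly_induct2)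
      (simp_all add: pCons is_ring_homD[OF h] algebra_simps)
  have smult: "?e (smult a q) = h a * ?e q" for a q
    by (induction q) (simp_all add: pCons is_ring_homD[OF h] algebra_simps)
  have "?e (p * q) = ?e p * ?e q" for p q
    by (induction p) (simp_all add: pCons add smult is_ring_homD[OF h] algebra_simps)
  moreover have "?e 1 = 1"
    by (simp add: is_ring_homD[OF h])
  ultimately show ?thesis
    using add zero by (simp add: is_ring_hom_def)
qed

text \<open>As \<open>x\<close> has no constant term, the constant coefficient of the value is
  \<open>h a\<close>, so \<open>a = 0\<close>; then \<open>x\<close> can be cancelled and the
  argument repeats.\<close>

lemma eval_poly_fps_inj:
  fixes h :: "'a::comm_ring_1 \<Rightarrow> 'b::idom"
  assumes h: "is_ring_hom h" "\<And>a. h a = 0 \<Longrightarrow> a = 0" and x: "x $ 0 = 0" "x \<noteq> 0"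
    and "poly (map_poly (\<lambda>a. fps_const (h a)) p) x = 0"
  shows "p = 0"
  using assms(5)
proof (induction p)
  case (pCons a p)
  have eq: "fps_const (h a) + x * poly (map_poly (\<lambda>a. fps_const (h a)) p) x = 0"
    using pCons.prems by (simp add: map_poly_pCons is_ring_homD[OF h(1)])
  have "(fps_const (h a) + x * poly (map_poly (\<lambda>a. fps_const (h a)) p) x) $ 0 = 0 $ 0"
    by (simp only: eq)
  then have "h a = 0" using x(1) by simp
  with eq x(2) have "poly (map_poly (\<lambda>a. fps_const (h a)) p) x = 0" by simp
  then show ?case using pCons.IH h(2)[OF \<open>h a = 0\<close>] by simp
qed simp

lemma udr_le:
  assumes "inj \<pi>" "1 \<le> n"
  shows "udr n \<pi> \<le> n"
  using udr_eq_changes[OF assms] changes_le[of "updown \<pi> True" "n - 1"] assms(2) by simp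

text \<open>Clears denominators for a = c / b; the bound \<open>k \<le> n\<close> keeps the exponent
  of \<open>b\<close> natural.\<close>

lemma power_substitution:
  fixes a b c :: "'a::comm_ring_1"
  assumes "a * b = c" "k \<le> n"
  shows "b ^ n * a ^ k = c ^ k * b ^ (n - k)"
proof -
  have "b ^ n = b ^ k * b ^ (n - k)" using assms(2) by (simp flip: power_add)
  then have "b ^ n * a ^ k = (a * b) ^ k * b ^ (n - k)"
    by (simp only: power_mult_distrib mult_ac)
  then show ?thesis using assms(1) by simp
qed

lemma udr_series:
  fixes S :: "'a::idom fps"
  assumes \<pi>: "inj \<pi>" and n: "1 \<le> n" and S: "S * (1 + fps_X\<^sup>2) = 2 * fps_X"
  shows "(1 + fps_X\<^sup>2) ^ n * S ^ udr n \<pi> =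
    2 * (1 - fps_X)\<^sup>2 * (1 - fps_X\<^sup>2) ^ (n - 1) * chain_words_series odd (ascent \<pi>) n"
proof -
  let ?X = "fps_X :: 'a fps"
  let ?d = "updown \<pi> True"
  define U where "U = (chain_words_series odd (ascent \<pi>) n :: 'a fps)"
  obtain m where m: "n = Suc m" using n by (cases n) auto
  define c where "c = changes ?d m"
  have c: "udr n \<pi> = Suc c" using udr_eq_changes[OF \<pi> n] by (simp add: m c_def)
  have "chain_words odd (ascent \<pi>) L n = chain_words odd ?d L n" for L
    by (rule chain_words_cong) (simp add: updown_def)
  then have "(1 - ?X\<^sup>2) ^ (m + 2) * U = (1 + ?X)\<^sup>2 * (?X * (2 * ?X) ^ c * (1 + ?X\<^sup>2) ^ (m - c))"
    using chain_words_series_odd[of ?d m, where 'a = 'a]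
    by (simp add: U_def chain_words_series_def m c_def updown_def)
  \<comment> \<open>The factor (1 + X)^2 of \<open>chain_words_series_odd\<close> cancels against (1
    - X^2)^2 and leaves (1 - X)^2, which is why this square stands apart from the power of 1 -
    X^2.\<close>
  moreover have "(1 - ?X\<^sup>2) ^ (m + 2) * U = (1 + ?X)\<^sup>2 * ((1 - ?X)\<^sup>2 * (1 - ?X\<^sup>2) ^ m * U)"
    by (simp only: power_add one_minus_X2 power_mult_distrib mult_ac)
  moreover have "(1 + ?X)\<^sup>2 \<noteq> 0" by (auto dest: arg_cong[of _ _ "\<lambda>f. f $ 0"])
  ultimately have U: "(1 - ?X)\<^sup>2 * (1 - ?X\<^sup>2) ^ m * U = ?X * (2 * ?X) ^ c * (1 + ?X\<^sup>2) ^ (m - c)"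
    by (metis mult_left_cancel)
  have "(1 + ?X\<^sup>2) ^ n * S ^ udr n \<pi> = (2 * ?X) ^ udr n \<pi> * (1 + ?X\<^sup>2) ^ (n - udr n \<pi>)"
    by (rule power_substitution[OF S udr_le[OF \<pi> n]])
  also have "\<dots> = 2 * (?X * (2 * ?X) ^ c * (1 + ?X\<^sup>2) ^ (m - c))"
    unfolding c by (simp only: m power_Suc diff_Suc_Suc mult_ac)
  also have "\<dots> = 2 * (1 - ?X)\<^sup>2 * (1 - ?X\<^sup>2) ^ (n - 1) * U"
    unfolding U[symmetric] by (simp only: m diff_Suc_1 mult_ac)
  finally show ?thesis by (simp only: U_def)
qed

lemma pk_series:
  fixes T :: "'a::comm_ring_1 fps"
  assumes \<pi>: "inj \<pi>" and n: "1 \<le> n" and T: "T * (1 + fps_X)\<^sup>2 = 4 * fps_X"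
  shows "(1 + fps_X) ^ (n + 1) * T ^ (pk n \<pi> + 1) = 2 * (1 - fps_X) ^ (n + 1) *
    Abs_fps (\<lambda>j. of_nat (card (chain_words even (ascent \<pi>) {1..2 * j} n)))"
proof -
  let ?X = "fps_X :: 'a fps"
  let ?d = "updown \<pi> False"
  define V where "V = (Abs_fps (\<lambda>j. of_nat (card (chain_words even (ascent \<pi>) {1..2 * j} n))) :: 'a fps)"
  obtain m where m: "n = Suc m" using n by (cases n) auto
  define q where "q = changes ?d m div 2"
  have q: "pk n \<pi> = q"
    using pk_eq[OF \<pi>, of n] peaks_eq_changes[of ?d m] by (simp add: m q_def updown_def)
  have le: "2 * q \<le> m" using changes_le[of ?d m] by (simp add: q_def)
  have "chain_words even (ascent \<pi>) L n = chain_words even ?d L n" for L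
    by (rule chain_words_cong) (simp add: updown_def)
  then have V: "(1 - ?X) ^ (m + 2) * V = 2 * 4 ^ q * ?X ^ (q + 1) * (1 + ?X) ^ (m - 2 * q)"
    using chain_words_series_even[of ?d m, where 'a = 'a] by (simp add: V_def m q_def updown_def)
  have "(1 + ?X) ^ (n + 1) * T ^ (pk n \<pi> + 1) =
      (1 + ?X) ^ (m - 2 * q) * (((1 + ?X)\<^sup>2) ^ (q + 1) * T ^ (q + 1))"
  proof -
    \<comment> \<open>Each of the \<open>q + 1\<close> factors \<open>T\<close> absorbs one (1 +
      X)^2.\<close>
    have "n + 1 = (m - 2 * q) + 2 * (q + 1)" using le m by simp
    then show ?thesis unfolding q by (simp only: power_add power_mult mult.assoc)
  qed
  also have "((1 + ?X)\<^sup>2) ^ (q + 1) * T ^ (q + 1) = (4 * ?X) ^ (q + 1)"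
    using power_substitution[OF T, of "q + 1" "q + 1"] by simp
  also have "(1 + ?X) ^ (m - 2 * q) * (4 * ?X) ^ (q + 1) =
      2 * (2 * 4 ^ q * ?X ^ (q + 1) * (1 + ?X) ^ (m - 2 * q))"
  proof -
    have "(4 :: 'a fps) ^ (q + 1) = 2 * (2 * 4 ^ q)" by simp
    then show ?thesis by (simp only: power_mult_distrib mult_ac)
  qed
  also have "\<dots> = 2 * (1 - ?X) ^ (n + 1) * V"
    unfolding V[symmetric] by (simp only: m add_2_eq_Suc' Suc_eq_plus1[symmetric] mult.assoc)
  finally show ?thesis by (simp only: V_def)
qed

lemma sum_chain_words_series:
  "(\<Sum>\<pi> | \<pi> permutes {1..n}. chain_words_series \<phi> (ascent \<pi>) n) =
    Abs_fps (\<lambda>m. of_nat m ^ n :: 'a::comm_ring_1)"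
proof (rule fps_ext)
  fix m
  show "(\<Sum>\<pi> | \<pi> permutes {1..n}. chain_words_series \<phi> (ascent \<pi>) n) $ m =
      Abs_fps (\<lambda>m. of_nat m ^ n :: 'a) $ m"
    using arg_cong[OF sum_card_chain_words_permutations[of "{1..m}" \<phi> n], of "of_nat :: nat \<Rightarrow> 'a"]
    by (simp add: fps_sum_nth chain_words_series_def)
qed

lemma sum_even_chain_words_series:
  "(\<Sum>\<pi> | \<pi> permutes {1..n}. Abs_fps (\<lambda>j. of_nat (card (chain_words \<phi> (ascent \<pi>) {1..2 * j} n)))) =
    Abs_fps (\<lambda>j. of_nat (2 * j) ^ n :: 'a::comm_ring_1)"
proof (rule fps_ext)
  fix j
  show "(\<Sum>\<pi> | \<pi> permutes {1..n}.
        Abs_fps (\<lambda>j. of_nat (card (chain_words \<phi> (ascent \<pi>) {1..2 * j} n)))) $ j =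
      Abs_fps (\<lambda>j. of_nat (2 * j) ^ n :: 'a) $ j"
    using arg_cong[OF sum_card_chain_words_permutations[of "{1..2 * j}" \<phi> n], of "of_nat :: nat \<Rightarrow> 'a"]
    by (simp add: fps_sum_nth)
qed

text \<open>Since \<open>0 ^ 0 = 1\<close>, the series for \<open>k = 0\<close> has constant term 1,
  which matches \<open>eulerian_A 0 = 1\<close>.\<close>

definition pow_series :: "nat \<Rightarrow> 'a::comm_ring_1 fps" where
  "pow_series k = Abs_fps (\<lambda>m. of_nat m ^ k)"

text \<open>The classical series of the Eulerian polynomials: each permutation contributes
  X^(des+1)/(1-X)^(k+1) by \<open>chain_words_series_True\<close>, and together the chain words
  count all words of length k.\<close>

lemma eulerian_A_fps_X: "eulerian_A k fps_X = (1 - fps_X) ^ (k + 1) * (pow_series k :: 'a::comm_ring_1 fps)"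
proof (cases k)
  case 0
  have "(1 - fps_X) * Abs_fps (\<lambda>_. 1) = (1 :: 'a fps)"
  proof (rule fps_ext)
    fix m show "((1 - fps_X) * Abs_fps (\<lambda>_. 1)) $ m = (1 :: 'a fps) $ m"
      by (cases m) (simp_all add: left_diff_distrib)
  qed
  then show ?thesis by (simp add: 0 eulerian_A_def pow_series_def)
next
  case (Suc m)
  have "(fps_X :: 'a fps) ^ (des k \<pi> + 1) =
      (1 - fps_X) ^ (k + 1) * chain_words_series (\<lambda>_. True) (ascent \<pi>) k" if "\<pi> permutes {1..k}" for \<pi>
    using des_eq[OF permutes_inj[OF that], of k] chain_words_series_True[of m "ascent \<pi>", where 'a = 'a]
    by (simp add: Suc)
  then have "eulerian_A k (fps_X :: 'a fps) =
      (\<Sum>\<pi> | \<pi> permutes {1..k}. (1 - fps_X) ^ (k + 1) * chain_words_series (\<lambda>_. True) (ascent \<pi>) k)"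
    unfolding eulerian_A_def using Suc by simp
  then show ?thesis
    unfolding sum_distrib_left[symmetric] sum_chain_words_series pow_series_def .
qed

lemma P_udr_series:
  fixes S :: "'a::idom fps"
  assumes "1 \<le> k" "S * (1 + fps_X\<^sup>2) = 2 * fps_X"
  shows "(1 + fps_X\<^sup>2) ^ k * P_udr k S = 2 * (1 - fps_X)\<^sup>2 * (1 - fps_X\<^sup>2) ^ (k - 1) * pow_series k"
proof -
  have "(1 + fps_X\<^sup>2) ^ k * P_udr k S = (\<Sum>\<pi> | \<pi> permutes {1..k}. (1 + fps_X\<^sup>2) ^ k * S ^ udr k \<pi>)"
    using assms(1) by (simp add: P_udr_def sum_distrib_left)
  also have "\<dots> = (\<Sum>\<pi> | \<pi> permutes {1..k}.
      2 * (1 - fps_X)\<^sup>2 * (1 - fps_X\<^sup>2) ^ (k - 1) * chain_words_series odd (ascent \<pi>) k)"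
    by (intro sum.cong refl udr_series assms permutes_inj) simp
  finally show ?thesis
    unfolding sum_distrib_left[symmetric] sum_chain_words_series pow_series_def .
qed

text \<open>The factor 2^k stems from the alphabets {1..2j}.\<close>

lemma P_pk_series:
  fixes T :: "'a::comm_ring_1 fps"
  assumes "1 \<le> k" "T * (1 + fps_X)\<^sup>2 = 4 * fps_X"
  shows "(1 + fps_X) ^ (k + 1) * P_pk k T = 2 * (1 - fps_X) ^ (k + 1) * (2 ^ k * pow_series k)"
proof -
  have "(1 + fps_X) ^ (k + 1) * P_pk k T =
      (\<Sum>\<pi> | \<pi> permutes {1..k}. (1 + fps_X) ^ (k + 1) * T ^ (pk k \<pi> + 1))"
    using assms(1) by (simp add: P_pk_def sum_distrib_left del: power_Suc)
  also have "\<dots> = (\<Sum>\<pi> | \<pi> permutes {1..k}. 2 * (1 - fps_X) ^ (k + 1) *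
      Abs_fps (\<lambda>j. of_nat (card (chain_words even (ascent \<pi>) {1..2 * j} k))))"
    by (intro sum.cong refl pk_series assms permutes_inj) simp
  also have "\<dots> = 2 * (1 - fps_X) ^ (k + 1) * Abs_fps (\<lambda>j. of_nat (2 * j) ^ k)"
    unfolding sum_distrib_left[symmetric] sum_even_chain_words_series ..
  also have "Abs_fps (\<lambda>j. of_nat (2 * j) ^ k) = (2 ^ k * pow_series k :: 'a fps)"
  proof (rule fps_ext)
    fix j
    have "(2 ^ k :: 'a fps) = fps_const (2 ^ k)" by (simp add: numeral_fps_const)
    then show "Abs_fps (\<lambda>j. of_nat (2 * j) ^ k) $ j = (2 ^ k * pow_series k :: 'a fps) $ j"
      by (simp only: fps_mult_left_const_nth pow_series_def fps_nth_Abs_fps of_nat_mult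
          power_mult_distrib of_nat_numeral)
  qed
  finally show ?thesis .
qed

section \<open>Bivariate generating functions\<close>

lemma fps2_divide_eqI:
  fixes f g h :: "'a::field fps fps"
  assumes "f $ 0 $ 0 \<noteq> 0" "g * f = h"
  shows "h / f = g"
  unfolding fps2_divide(2)[OF assms(1)] assms(2)[symmetric] mult.assoc fps2_divide(1)[OF assms(1)]
  by (rule mult_1_right)

lemma fps2_divide_mult:
  fixes f g :: "'a::field fps fps"
  assumes "f $ 0 $ 0 \<noteq> 0"
  shows "g / f * f = g"
  unfolding fps2_divide(2)[OF assms] using fps2_divide(1)[OF assms]
  by (simp only: mult.assoc mult.commute[of "inverse f"] mult_1_right)

text \<open>Being a ring homomorphism says nothing about quotients; \<open>fps_const\<close>
  preserves those with invertible denominator.\<close>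

lemma fps_const_divide:
  fixes f g :: "'a::field fps fps"
  assumes "f $ 0 $ 0 \<noteq> 0"
  shows "fps_const g / fps_const f = fps_const (g / f)"
proof -
  have u: "fps_const f $ 0 $ 0 $ 0 \<noteq> 0" using assms by simp
  have "fps_const g = fps_const (g / f) * fps_const f"
    using fps2_divide_mult[OF assms, of g] by simp
  then have "fps_const g / fps_const f = fps_const (g / f) * (fps_const f * inverse (fps_const f))"
    unfolding fps3_divide(2)[OF u] by (simp only: mult.assoc)
  then show ?thesis unfolding fps3_divide(1)[OF u] by simp
qed

text \<open>The coefficient of x^n on both sides of (a) and the common value in (b). The index
  \<open>m\<close> belongs to the inner variable s, \<open>j\<close> to the outer variable
  t.\<close>

definition joint_series :: "nat \<Rightarrow> rat fps fps" where
  "joint_series n = Abs_fps (\<lambda>j. Abs_fps (\<lambda>m. (((1 + fps_X) / (1 - fps_X)) ^ (m * j)) $ n))"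

lemma of_nat_mult_nth_nth: "(of_nat a * F :: rat fps fps) $ j $ m = of_nat a * F $ j $ m"
  by (simp flip: fps_of_nat)

lemma joint_series_eq_sum:
  "joint_series n = (\<Sum>\<pi> | \<pi> permutes {1..n}. fps_const (chain_words_series odd (ascent \<pi>) n) *
     Abs_fps (\<lambda>j. of_nat (card (chain_words even (ascent (inv \<pi>)) {1..2 * j} n))))"
proof (intro fps_ext)
  fix j m
  have "(fps_const (chain_words_series odd (ascent \<pi>) n) *
      Abs_fps (\<lambda>j. of_nat (card (chain_words even (ascent (inv \<pi>)) {1..2 * j} n)))) $ j $ m =
      rat_of_nat (card (chain_words odd (ascent \<pi>) {1..m} n) *
        card (chain_words even (ascent (inv \<pi>)) {1..2 * j} n))" for \<pi>
    by (simp add: chain_words_series_def flip: fps_of_nat)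
  note term_nth = this
  have "joint_series n $ j $ m = rat_of_nat (\<Sum>\<pi> | \<pi> permutes {1..n}.
      card (chain_words odd (ascent \<pi>) {1..m} n) *
      card (chain_words even (ascent (inv \<pi>)) {1..2 * j} n))"
    unfolding sum_card_chain_words by (simp only: joint_series_def fps_nth_Abs_fps)
  then show "joint_series n $ j $ m =
      (\<Sum>\<pi> | \<pi> permutes {1..n}. fps_const (chain_words_series odd (ascent \<pi>) n) *
        Abs_fps (\<lambda>j. of_nat (card (chain_words even (ascent (inv \<pi>)) {1..2 * j} n)))) $ j $ m"
    by (simp only: fps_sum_nth term_nth of_nat_sum)
qed

lemmas fps_const_hom = is_ring_homD(2-4)[OF is_ring_hom_fps_const]
  is_ring_hom_power[OF is_ring_hom_fps_const] is_ring_hom_diff[OF is_ring_hom_fps_const]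
  numeral_fps_const[symmetric]

lemma P_udr_ipk_series:
  fixes S :: "rat fps" and T :: "rat fps fps"
  defines "s \<equiv> fps_const fps_X :: rat fps fps" and "t \<equiv> fps_X :: rat fps fps"
  assumes n: "1 \<le> n" and S: "S * (1 + fps_X\<^sup>2) = 2 * fps_X" and T: "T * (1 + t)\<^sup>2 = 4 * t"
  shows "(1 + s\<^sup>2) ^ n * (1 + t) ^ (n + 1) * P_udr_ipk n (fps_const S) T =
    4 * (1 - s)\<^sup>2 * (1 - s\<^sup>2) ^ (n - 1) * (1 - t) ^ (n + 1) * joint_series n"
proof -
  let ?U = "\<lambda>\<pi>. fps_const (chain_words_series odd (ascent \<pi>) n)"
  let ?V = "\<lambda>\<pi>. Abs_fps (\<lambda>j. of_nat (card (chain_words even (ascent (inv \<pi>)) {1..2 * j} n)))"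
  let ?c = "4 * (1 - s)\<^sup>2 * (1 - s\<^sup>2) ^ (n - 1) * (1 - t) ^ (n + 1)"
  have "(1 + s\<^sup>2) ^ n * (1 + t) ^ (n + 1) * (fps_const S ^ udr n \<pi> * T ^ (ipk n \<pi> + 1)) =
      ?c * (?U \<pi> * ?V \<pi>)" if "\<pi> permutes {1..n}" for \<pi>
  proof -
    have "(1 + s\<^sup>2) ^ n * fps_const S ^ udr n \<pi> = 2 * (1 - s)\<^sup>2 * (1 - s\<^sup>2) ^ (n - 1) * ?U \<pi>"
      using arg_cong[OF udr_series[OF permutes_inj[OF that] n S], of fps_const]
      unfolding s_def fps_const_hom .
    moreover have "(1 + t) ^ (n + 1) * T ^ (ipk n \<pi> + 1) = 2 * (1 - t) ^ (n + 1) * ?V \<pi>"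
      unfolding ipk_def t_def
      by (rule pk_series[OF permutes_inj[OF permutes_inv[OF that]] n T[unfolded t_def]])
    moreover have "(4 :: rat fps fps) = 2 * 2" by simp
    moreover have "(1 + s\<^sup>2) ^ n * (1 + t) ^ (n + 1) * (fps_const S ^ udr n \<pi> * T ^ (ipk n \<pi> + 1)) =
        ((1 + s\<^sup>2) ^ n * fps_const S ^ udr n \<pi>) * ((1 + t) ^ (n + 1) * T ^ (ipk n \<pi> + 1))"
      by (simp only: mult_ac)
    ultimately show ?thesis by (simp only: mult_ac)
  qed
  then have "(\<Sum>\<pi> | \<pi> permutes {1..n}. (1 + s\<^sup>2) ^ n * (1 + t) ^ (n + 1) *
      (fps_const S ^ udr n \<pi> * T ^ (ipk n \<pi> + 1))) = (\<Sum>\<pi> | \<pi> permutes {1..n}. ?c * (?U \<pi> * ?V \<pi>))"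
    by (intro sum.cong) simp_all
  then show ?thesis
    unfolding P_udr_ipk_def joint_series_eq_sum sum_distrib_left .
qed

text \<open>The power (2mj)^k separates into m^k, summed in s, and 2^k j^k, summed in t.\<close>

lemma joint_series_odd_cycles:
  "of_nat (fact n) * joint_series n = (\<Sum>k = 0..n. of_nat (odd_cycles_perms n k) *
     (fps_const (pow_series k) * (2 ^ k * pow_series k)))"
proof (intro fps_ext)
  fix j m
  have "(of_nat (odd_cycles_perms n k) * (fps_const (pow_series k) * (2 ^ k * pow_series k))
        :: rat fps fps) $ j $ m = of_nat (odd_cycle_number n k) * (2 * of_nat (m * j)) ^ k" for k
  proof -
    have "of_nat (odd_cycles_perms n k) * (fps_const (pow_series k) * (2 ^ k * pow_series k)) =
        of_nat (odd_cycles_perms n k * 2 ^ k) * (fps_const (pow_series k) * pow_series k :: rat fps fps)"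
      by (simp add: mult_ac)
    moreover have "(fps_const (pow_series k) * pow_series k :: rat fps fps) $ j $ m = of_nat (m * j) ^ k"
    proof -
      have "(of_nat j ^ k :: rat fps) = fps_const (of_nat j ^ k)"
        by (simp flip: fps_of_nat)
      then show ?thesis by (simp add: pow_series_def power_mult_distrib)
    qed
    ultimately show ?thesis
      by (simp only: of_nat_mult_nth_nth odd_cycles_perms_eq_odd_cycle_number)
        (simp add: power_mult_distrib)
  qed
  moreover have "(of_nat (fact n) * joint_series n) $ j $ m =
      (\<Sum>k\<le>n. of_nat (odd_cycle_number n k) * (2 * of_nat (m * j)) ^ k)"
    unfolding of_nat_mult_nth_nth odd_cycle_number_series[symmetric]
    by (simp add: joint_series_def)
  ultimately show "(of_nat (fact n) * joint_series n) $ j $ m =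
      (\<Sum>k = 0..n. of_nat (odd_cycles_perms n k) *
        (fps_const (pow_series k) * (2 ^ k * pow_series k))) $ j $ m"
    by (simp add: fps_sum_nth atLeast0AtMost)
qed

text \<open>After multiplication by the prefactor of \<open>P_udr_ipk_series\<close>, term k becomes
  term k of \<open>joint_series_odd_cycles\<close>. The series for \<open>P_udr\<close> and
  \<open>P_pk\<close> absorb only the powers belonging to k; the squares in \<open>S2\<close> and
  \<open>T2\<close> account for the remaining n - k.\<close>

lemma P_udr_ipk_convolution:
  fixes S :: "rat fps" and T :: "rat fps fps"
  assumes n: "1 \<le> n" and S: "S * (1 + fps_X\<^sup>2) = 2 * fps_X" and T: "T * (1 + fps_X)\<^sup>2 = 4 * fps_X"
  shows "of_nat (fact n) * P_udr_ipk n (fps_const S) T = (\<Sum>k = 0..n. of_nat (odd_cycles_perms n k) *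
    ((1 - (fps_const S)\<^sup>2) * (1 - T)) ^ ((n - k) div 2) * P_udr k (fps_const S) * P_pk k T)"
proof -
  let ?s = "fps_const fps_X :: rat fps fps"
  let ?t = "fps_X :: rat fps fps"
  let ?S = "fps_const S"
  let ?b = "(1 + ?s\<^sup>2) ^ n * (1 + ?t) ^ (n + 1)"
  let ?c = "4 * (1 - ?s)\<^sup>2 * (1 - ?s\<^sup>2) ^ (n - 1) * (1 - ?t) ^ (n + 1)"
  have S2: "(1 + ?s\<^sup>2)\<^sup>2 * (1 - ?S\<^sup>2) = (1 - ?s\<^sup>2)\<^sup>2"
  proof -
    have "(1 + ?s\<^sup>2)\<^sup>2 * (1 - ?S\<^sup>2) = (1 + ?s\<^sup>2)\<^sup>2 - (?S * (1 + ?s\<^sup>2))\<^sup>2"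
      by (simp only: right_diff_distrib mult_1_right power_mult_distrib
          mult.commute[of _ "?S\<^sup>2"])
    also have "?S * (1 + ?s\<^sup>2) = 2 * ?s"
      using arg_cong[OF S, of fps_const] unfolding fps_const_hom .
    also have "(1 + ?s\<^sup>2)\<^sup>2 - (2 * ?s)\<^sup>2 = (1 - ?s\<^sup>2)\<^sup>2"
    proof -
      have "(1 + a\<^sup>2)\<^sup>2 - (2 * a)\<^sup>2 = (1 - a\<^sup>2)\<^sup>2" for a :: "'b::comm_ring_1"
        by (simp add: power2_eq_square algebra_simps)
      then show ?thesis .
    qed
    finally show ?thesis .
  qed
  have T2: "(1 + ?t)\<^sup>2 * (1 - T) = (1 - ?t)\<^sup>2"
  proof -
    have "(1 + ?t)\<^sup>2 * (1 - T) = (1 + ?t)\<^sup>2 - T * (1 + ?t)\<^sup>2"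
      by (simp only: right_diff_distrib mult_1_right mult.commute[of _ T])
    also have "\<dots> = (1 - ?t)\<^sup>2"
    proof -
      have "(1 + a)\<^sup>2 - 4 * a = (1 - a)\<^sup>2" for a :: "'b::comm_ring_1"
        by (simp add: power2_eq_square algebra_simps)
      then show ?thesis unfolding T .
    qed
    finally show ?thesis .
  qed
  have "?b * (of_nat (odd_cycles_perms n k) *
      ((1 - ?S\<^sup>2) * (1 - T)) ^ ((n - k) div 2) * P_udr k ?S * P_pk k T) =
      ?c * (of_nat (odd_cycles_perms n k) * (fps_const (pow_series k) * (2 ^ k * pow_series k)))"
    if "k \<in> {0..n}" for k
  \<comment> \<open>For odd n - k and for k = 0 the coefficient vanishes, and with it both
    sides.\<close>
  proof (cases "odd_cycle_number n k = 0")
    case False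
    define q where "q = (n - k) div 2"
    have nk: "n = q + q + k"
    proof -
      have "k \<le> n" "even (n - k)"
        using odd_cycle_number_nonzero[OF False] by blast+
      moreover from this(2) have "2 * ((n - k) div 2) = n - k"
        by (rule dvd_mult_div_cancel)
      ultimately show ?thesis unfolding q_def by linarith
    qed
    have k: "1 \<le> k"
      using False n odd_cycle_number_Suc_0[of "n - 1"] by (cases k) auto
    have udr: "(1 + ?s\<^sup>2) ^ k * P_udr k ?S =
        2 * (1 - ?s)\<^sup>2 * (1 - ?s\<^sup>2) ^ (k - 1) * fps_const (pow_series k)"
      using arg_cong[OF P_udr_series[OF k S], of fps_const]
      unfolding fps_const_hom is_ring_hom_P_udr[OF is_ring_hom_fps_const] .
    have pk: "(1 + ?t) ^ (k + 1) * P_pk k T = 2 * (1 - ?t) ^ (k + 1) * (2 ^ k * pow_series k)"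
      by (rule P_pk_series[OF k T])
    have e: "n - 1 = q + q + (k - 1)" "n + 1 = q + q + (k + 1)" using nk k by auto
    have "?b * (((1 - ?S\<^sup>2) * (1 - T)) ^ q * P_udr k ?S * P_pk k T) =
        ((1 + ?s\<^sup>2)\<^sup>2 * (1 - ?S\<^sup>2)) ^ q * ((1 + ?t)\<^sup>2 * (1 - T)) ^ q *
        (((1 + ?s\<^sup>2) ^ k * P_udr k ?S) * ((1 + ?t) ^ (k + 1) * P_pk k T))"
      unfolding e(2) by (subst nk) (simp only: power_add power2_eq_square power_mult_distrib mult_ac)
    also have "\<dots> = ((1 - ?s\<^sup>2)\<^sup>2) ^ q * ((1 - ?t)\<^sup>2) ^ q *
        ((2 * (1 - ?s)\<^sup>2 * (1 - ?s\<^sup>2) ^ (k - 1) * fps_const (pow_series k)) *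
         (2 * (1 - ?t) ^ (k + 1) * (2 ^ k * pow_series k)))"
      unfolding S2 T2 udr pk ..
    also have "\<dots> = ?c * (fps_const (pow_series k) * (2 ^ k * pow_series k))"
    proof -
      have "(4 :: rat fps fps) = 2 * 2" by simp
      then show ?thesis unfolding e by (simp only: power_add power2_eq_square power_mult_distrib mult_ac)
    qed
    finally have "of_nat (odd_cycles_perms n k) *
          (?b * (((1 - ?S\<^sup>2) * (1 - T)) ^ q * P_udr k ?S * P_pk k T)) =
        of_nat (odd_cycles_perms n k) * (?c * (fps_const (pow_series k) * (2 ^ k * pow_series k)))"
      by (rule arg_cong)
    then show ?thesis unfolding q_def by (simp only: mult_ac)
  qed (simp add: odd_cycles_perms_eq_odd_cycle_number)
  then have "(\<Sum>k = 0..n. ?b * (of_nat (odd_cycles_perms n k) *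
      ((1 - ?S\<^sup>2) * (1 - T)) ^ ((n - k) div 2) * P_udr k ?S * P_pk k T)) =
      (\<Sum>k = 0..n. ?c * (of_nat (odd_cycles_perms n k) *
        (fps_const (pow_series k) * (2 ^ k * pow_series k))))"
    by (rule sum.cong[OF refl])
  also have "\<dots> = ?c * (of_nat (fact n) * joint_series n)"
    unfolding joint_series_odd_cycles sum_distrib_left ..
  also have "\<dots> = of_nat (fact n) * (?c * joint_series n)"
    by (simp only: mult_ac)
  also have "\<dots> = ?b * (of_nat (fact n) * P_udr_ipk n ?S T)"
    unfolding P_udr_ipk_series[OF n S T, symmetric] by (simp only: mult_ac)
  finally have eq: "?b * (of_nat (fact n) * P_udr_ipk n ?S T) = ?b * (\<Sum>k = 0..n. of_nat (odd_cycles_perms n k) *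
      ((1 - ?S\<^sup>2) * (1 - T)) ^ ((n - k) div 2) * P_udr k ?S * P_pk k T)"
    unfolding sum_distrib_left by (rule sym)
  have "?b \<noteq> 0"
  proof -
    have "?b $ 0 $ 0 = 1" by (simp add: fps_nth_power_0)
    then show ?thesis by (metis fps_zero_nth zero_neq_one)
  qed
  from iffD1[OF mult_left_cancel[OF this] eq] show ?thesis .
qed

text \<open>The product equations serve the cleared identities, the quotients the final statements;
  \<open>eval_poly_fps_inj\<close> needs that S and T are nonzero without constant term.\<close>

lemma exists_rational_substitutions:
  obtains S :: "rat fps" and T :: "rat fps fps"
  where "S * (1 + fps_X\<^sup>2) = 2 * fps_X" "S $ 0 = 0" "S \<noteq> 0"
    "T * (1 + fps_X)\<^sup>2 = 4 * fps_X" "T $ 0 = 0" "T \<noteq> 0"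
    "fps_const S = 2 * fps_const fps_X / (1 + (fps_const fps_X)\<^sup>2)" "T = 4 * fps_X / (1 + fps_X)\<^sup>2"
proof
  define S :: "rat fps" where "S = 2 * fps_X * inverse (1 + fps_X\<^sup>2)"
  define T :: "rat fps fps" where "T = 4 * fps_X / (1 + fps_X)\<^sup>2"
  have u: "((1 + fps_X)\<^sup>2 :: rat fps fps) $ 0 $ 0 \<noteq> 0"
    by (simp add: fps_nth_power_0)
  have T': "T = 4 * fps_X * inverse ((1 + fps_X)\<^sup>2)"
    unfolding T_def by (rule fps2_divide(2)[OF u])
  show S: "S * (1 + fps_X\<^sup>2) = 2 * fps_X"
    unfolding S_def mult.assoc by (subst inverse_mult_eq_1) simp_all
  show T: "T * (1 + fps_X)\<^sup>2 = 4 * fps_X"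
    unfolding T' mult.assoc using fps2_divide(1)[OF u] by (simp only: mult.commute mult_1_right mult_1_left)
  show "S $ 0 = 0" by (simp add: S_def)
  show "T $ 0 = 0" by (simp add: T')
  have "(2 * fps_X :: rat fps) $ 1 = 2" by (simp add: numeral_fps_const)
  then show "S \<noteq> 0" using S by auto
  have "(4 * fps_X :: rat fps fps) $ 1 = 4" by (simp add: numeral_fps_const)
  then show "T \<noteq> 0" using T by auto
  show "T = 4 * fps_X / (1 + fps_X)\<^sup>2" by (fact T_def)
  have v: "(1 + (fps_const fps_X)\<^sup>2 :: rat fps fps) $ 0 $ 0 \<noteq> 0" by simp
  have "fps_const S * (1 + (fps_const fps_X)\<^sup>2) = 2 * fps_const fps_X"
    using arg_cong[OF S, of fps_const] unfolding fps_const_hom .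
  then show "fps_const S = 2 * fps_const fps_X / (1 + (fps_const fps_X)\<^sup>2)"
    by (rule fps2_divide_eqI[OF v, symmetric])
qed

text \<open>The homomorphism \<open>\<psi>\<close> sends s to S and t to T. It is injective by
  \<open>eval_poly_fps_inj\<close>, applied first to the inner and then to the outer variable, and
  maps the claim times n! to \<open>P_udr_ipk_convolution\<close>.\<close>

lemma P_udr_ipk_poly_identity:
  fixes s t :: "rat poly poly"
  defines "s \<equiv> [:[:0, 1:]:]" and "t \<equiv> [:0, 1:]"
  assumes n: "1 \<le> n"
  shows "P_udr_ipk n s t = smult [:1 / fact n:] (\<Sum>k = 0..n. of_nat (odd_cycles_perms n k) *
    ((1 - s\<^sup>2) * (1 - t)) ^ ((n - k) div 2) * P_udr k s * P_pk k t)" (is "?P = smult _ ?R")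
proof -
  obtain S :: "rat fps" and T :: "rat fps fps"
    where S: "S * (1 + fps_X\<^sup>2) = 2 * fps_X" "S $ 0 = 0" "S \<noteq> 0"
      and T: "T * (1 + fps_X)\<^sup>2 = 4 * fps_X" "T $ 0 = 0" "T \<noteq> 0"
    by (rule exists_rational_substitutions)
  define \<phi> :: "rat poly \<Rightarrow> rat fps" where "\<phi> = (\<lambda>p. poly (map_poly (\<lambda>a. fps_const (id a)) p) S)"
  define \<psi> :: "rat poly poly \<Rightarrow> rat fps fps" where "\<psi> = (\<lambda>p. poly (map_poly (\<lambda>a. fps_const (\<phi> a)) p) T)"
  have \<phi>: "is_ring_hom \<phi>"
    unfolding \<phi>_def by (rule is_ring_hom_eval_poly) (simp add: is_ring_hom_def)
  have \<psi>: "is_ring_hom \<psi>"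
    unfolding \<psi>_def
    by (rule is_ring_hom_eval_poly) (simp add: is_ring_hom_def is_ring_homD[OF \<phi>])
  have "is_ring_hom (id :: rat \<Rightarrow> rat)" by (simp add: is_ring_hom_def)
  then have "p = 0" if "\<phi> p = 0" for p
    using eval_poly_fps_inj[of id S p] S(2,3) that unfolding \<phi>_def by simp
  then have inj: "p = 0" if "\<psi> p = 0" for p
    using eval_poly_fps_inj[OF \<phi> _ T(2,3)] that unfolding \<psi>_def by blast
  have "\<phi> [:0, 1:] = S" by (simp add: \<phi>_def map_poly_pCons)
  then have s: "\<psi> s = fps_const S"
    by (simp add: \<psi>_def s_def map_poly_pCons is_ring_homD[OF \<phi>])
  have t: "\<psi> t = T"
    by (simp add: \<psi>_def t_def map_poly_pCons is_ring_homD[OF \<phi>])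
  have "\<psi> (of_nat (fact n) * ?P - ?R) = 0"
    unfolding is_ring_hom_diff[OF \<psi>] is_ring_hom_sum[OF \<psi>] is_ring_homD[OF \<psi>]
      is_ring_hom_of_nat[OF \<psi>] is_ring_hom_power[OF \<psi>] is_ring_hom_P_udr[OF \<psi>]
      is_ring_hom_P_pk[OF \<psi>] is_ring_hom_P_udr_ipk[OF \<psi>] s t
      P_udr_ipk_convolution[OF n S(1) T(1)] by simp
  then have "of_nat (fact n) * ?P = ?R" using inj by fastforce
  moreover have "smult [:1 / fact n:] (of_nat (fact n) * ?P) = ?P"
  proof -
    have "(of_nat (fact n) :: rat poly poly) = [:[:fact n:]:]"
      by (simp add: of_nat_poly)
    then show ?thesis by (simp add: pCons_one)
  qed
  ultimately show ?thesis by simp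
qed

lemma P_udr_ipk_eq_joint_series:
  fixes s t :: "rat fps fps"
  defines "s \<equiv> fps_const fps_X" and "t \<equiv> fps_X"
  assumes n: "1 \<le> n"
  shows "1 / (4 * (1 - s)\<^sup>2) * ((1 + s\<^sup>2) ^ n / (1 - s\<^sup>2) ^ (n - 1)) * ((1 + t) / (1 - t)) ^ (n + 1) *
    P_udr_ipk n (2 * s / (1 + s\<^sup>2)) (4 * t / (1 + t)\<^sup>2) = joint_series n"
proof -
  obtain S :: "rat fps" and T :: "rat fps fps"
    where S: "S * (1 + fps_X\<^sup>2) = 2 * fps_X" "fps_const S = 2 * s / (1 + s\<^sup>2)"
      and T: "T * (1 + fps_X)\<^sup>2 = 4 * fps_X" "T = 4 * t / (1 + t)\<^sup>2"
    unfolding s_def t_def by (rule exists_rational_substitutions)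
  define A where "A = 4 * (1 - s)\<^sup>2"
  define B where "B = (1 - s\<^sup>2) ^ (n - 1)"
  define C where "C = 1 - t"
  have four: "(4 :: rat fps fps) $ 0 $ 0 = 4" by (simp add: numeral_fps_const)
  have A: "A $ 0 $ 0 \<noteq> 0" by (simp add: A_def s_def fps_nth_power_0 four)
  have B: "B $ 0 $ 0 \<noteq> 0" by (simp add: B_def s_def fps_nth_power_0)
  have C: "C $ 0 $ 0 \<noteq> 0" by (simp add: C_def t_def)
  let ?L = "1 / A * ((1 + s\<^sup>2) ^ n / B) * ((1 + t) / C) ^ (n + 1) * P_udr_ipk n (fps_const S) T"
  have "A * B * C ^ (n + 1) * ?L = (1 / A * A) * ((1 + s\<^sup>2) ^ n / B * B) * ((1 + t) / C * C) ^ (n + 1) *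
      P_udr_ipk n (fps_const S) T"
    by (simp only: power_mult_distrib mult_ac)
  also have "\<dots> = (1 + s\<^sup>2) ^ n * (1 + t) ^ (n + 1) * P_udr_ipk n (fps_const S) T"
    unfolding fps2_divide_mult[OF A] fps2_divide_mult[OF B] fps2_divide_mult[OF C]
    by (simp only: mult_1_left)
  also have "\<dots> = A * B * C ^ (n + 1) * joint_series n"
    unfolding A_def B_def C_def s_def t_def by (rule P_udr_ipk_series[OF n S(1) T(1)])
  finally have eq: "A * B * C ^ (n + 1) * ?L = A * B * C ^ (n + 1) * joint_series n" .
  have "(A * B * C ^ (n + 1)) $ 0 $ 0 \<noteq> 0"
    using A B C by (simp add: fps_nth_power_0)
  then have "A * B * C ^ (n + 1) \<noteq> 0" by (metis fps_zero_nth)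
  from iffD1[OF mult_left_cancel[OF this] eq] show ?thesis
    unfolding A_def B_def C_def S(2) T(2) .
qed

section \<open>Eulerian polynomials of types A and B\<close>

lemma fps_compose_X2_nth: "(f oo fps_X\<^sup>2) $ m = (if even m then f $ (m div 2) else (0 :: 'a::comm_ring_1))"
proof -
  have "(f oo fps_X\<^sup>2) $ m = (\<Sum>i = 0..m. if m = 2 * i then f $ i else 0)"
    unfolding fps_compose_nth power_mult[symmetric] by (intro sum.cong) auto
  also have "\<dots> = (\<Sum>i \<in> (if even m then {m div 2} else {}). f $ i)"
    by (rule sum.mono_neutral_cong_right) (auto split: if_splits elim!: evenE)
  finally show ?thesis by simp
qed

lemma eulerian_B_fps_X:
  "eulerian_B k (fps_X :: rat fps) = (1 - fps_X) ^ (k + 1) * Abs_fps (\<lambda>i. (2 * of_nat i + 1) ^ k)"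
proof -
  let ?p = "map_poly rat_of_int (eulerian_B_poly k)"
  have "poly (map_poly of_int q) (fps_X :: rat fps) = fps_of_poly (map_poly rat_of_int q)" for q
    by (induction q) (simp_all add: map_poly_pCons fps_of_poly_pCons fps_of_int mult.commute)
  then have "eulerian_B k (fps_X :: rat fps) = fps_of_poly ?p"
    by (simp only: eulerian_B_def)
  also have "\<dots> = fps_of_poly ?p / (1 - fps_X) ^ (k + 1) * (1 - fps_X) ^ (k + 1)"
  proof -
    have u: "((1 - fps_X) ^ (k + 1) :: rat fps) $ 0 \<noteq> 0" by (simp add: fps_nth_power_0)
    show ?thesis
      unfolding fps_divide_unit[OF u] mult.assoc inverse_mult_eq_1[OF u] by simp
  qed
  finally show ?thesis
    unfolding eulerian_B_poly_series by (simp only: mult.commute)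
qed

text \<open>In the series of m^k s^m, the even m = 2i give 2^k times the series of A_k at s^2, and
  the odd m = 2i + 1 give s times the series defining B_k at s^2.\<close>

lemma eulerian_AB_fps_X2:
  "2 ^ k * eulerian_A k (fps_X\<^sup>2) + fps_X * eulerian_B k (fps_X\<^sup>2) =
    (1 - fps_X\<^sup>2) ^ (k + 1) * (pow_series k :: rat fps)"
proof -
  let ?X = "fps_X :: rat fps"
  let ?g = "\<lambda>f :: rat fps. f oo ?X\<^sup>2"
  have hom: "is_ring_hom ?g" by (rule is_ring_hom_fps_compose) simp
  have X: "?g ?X = ?X\<^sup>2" by simp
  have "eulerian_A k (?X\<^sup>2) = (1 - ?X\<^sup>2) ^ (k + 1) * ?g (pow_series k)"
    using arg_cong[OF eulerian_A_fps_X[of k], of ?g]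
    unfolding is_ring_hom_eulerian_A[OF hom] is_ring_homD[OF hom] is_ring_hom_power[OF hom]
      is_ring_hom_diff[OF hom] X .
  moreover have "eulerian_B k (?X\<^sup>2) = (1 - ?X\<^sup>2) ^ (k + 1) * ?g (Abs_fps (\<lambda>i. (2 * of_nat i + 1) ^ k))"
    using arg_cong[OF eulerian_B_fps_X[of k], of ?g]
    unfolding is_ring_hom_eulerian_B[OF hom] is_ring_homD[OF hom] is_ring_hom_power[OF hom]
      is_ring_hom_diff[OF hom] X .
  moreover have "2 ^ k * ?g (pow_series k) + ?X * ?g (Abs_fps (\<lambda>i. (2 * of_nat i + 1) ^ k)) = pow_series k"
  proof (rule fps_ext)
    fix m
    have two: "(2 ^ k :: rat fps) = fps_const (2 ^ k)" by (simp add: numeral_fps_const)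
    show "(2 ^ k * ?g (pow_series k) + ?X * ?g (Abs_fps (\<lambda>i. (2 * of_nat i + 1) ^ k))) $ m =
        pow_series k $ m"
    proof (cases "even m")
      case True
      then obtain i where i: "m = 2 * i" by (elim evenE)
      then show ?thesis
        unfolding two fps_add_nth fps_mult_left_const_nth fps_X_mult_nth fps_compose_X2_nth
        by (simp add: pow_series_def power_mult_distrib)
    next
      case False
      then obtain i where i: "m = 2 * i + 1" by (elim oddE)
      then show ?thesis
        unfolding two fps_add_nth fps_mult_left_const_nth fps_X_mult_nth fps_compose_X2_nth
        by (simp add: pow_series_def add.commute)
    qed
  qed
  then have "(1 - ?X\<^sup>2) ^ (k + 1) * (2 ^ k * ?g (pow_series k) +
      ?X * ?g (Abs_fps (\<lambda>i. (2 * of_nat i + 1) ^ k))) = (1 - ?X\<^sup>2) ^ (k + 1) * pow_series k"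
    by (rule arg_cong)
  ultimately show ?thesis
    by (simp only: distrib_left mult_ac)
qed

lemma joint_series_eulerian:
  fixes s t :: "rat fps fps"
  defines "s \<equiv> fps_const fps_X" and "t \<equiv> fps_X"
  shows "joint_series n = 1 / of_nat (fact n) *
    (\<Sum>k = 0..n. 2 ^ k * of_nat (odd_cycles_perms n k) *
      (((2 ^ k * eulerian_A k (s\<^sup>2) + s * eulerian_B k (s\<^sup>2)) * eulerian_A k t) /
        ((1 - s\<^sup>2) ^ (k + 1) * (1 - t) ^ (k + 1))))"
proof -
  have quot: "((2 ^ k * eulerian_A k (s\<^sup>2) + s * eulerian_B k (s\<^sup>2)) * eulerian_A k t) /
      ((1 - s\<^sup>2) ^ (k + 1) * (1 - t) ^ (k + 1)) = fps_const (pow_series k) * pow_series k" for k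
  proof (rule fps2_divide_eqI)
    show "((1 - s\<^sup>2) ^ (k + 1) * (1 - t) ^ (k + 1)) $ 0 $ 0 \<noteq> 0"
      by (simp add: s_def t_def fps_nth_power_0)
    have "2 ^ k * eulerian_A k (s\<^sup>2) + s * eulerian_B k (s\<^sup>2) =
        (1 - s\<^sup>2) ^ (k + 1) * fps_const (pow_series k)"
      using arg_cong[OF eulerian_AB_fps_X2[of k], of fps_const]
      unfolding fps_const_hom is_ring_hom_eulerian_A[OF is_ring_hom_fps_const]
        is_ring_hom_eulerian_B[OF is_ring_hom_fps_const] s_def .
    then show "fps_const (pow_series k) * pow_series k * ((1 - s\<^sup>2) ^ (k + 1) * (1 - t) ^ (k + 1)) =
        (2 ^ k * eulerian_A k (s\<^sup>2) + s * eulerian_B k (s\<^sup>2)) * eulerian_A k t"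
      unfolding t_def eulerian_A_fps_X by (simp only: mult_ac)
  qed
  have u: "(of_nat (fact n) :: rat fps fps) $ 0 $ 0 \<noteq> 0"
    using of_nat_mult_nth_nth[of "fact n" 1 0 0] by simp
  have "joint_series n = 1 / of_nat (fact n) * (of_nat (fact n) * joint_series n)"
    using fps2_divide_mult[OF u, of 1] by (simp only: mult.assoc[symmetric] mult_1_left)
  then show ?thesis
    unfolding joint_series_odd_cycles quot by (simp only: mult_ac)
qed

text \<open>Embeds series in x alone into the ring with x as outermost variable, so that powers of
  (1+x)/(1-x) can be expanded over the rationals.\<close>

definition lift_x :: "rat fps \<Rightarrow> rat fps fps fps" where
  "lift_x f = Abs_fps (\<lambda>c. fps_const (fps_const (f $ c)))"

lemma is_ring_hom_lift_x: "is_ring_hom lift_x"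
  unfolding is_ring_hom_def
proof (intro conjI allI)
  show "lift_x (f * g) = lift_x f * lift_x g" for f g
    by (rule fps_ext)
      (simp add: lift_x_def fps_mult_nth is_ring_hom_sum[OF is_ring_hom_fps_const])
qed (auto simp: lift_x_def fps_eq_iff)

lemma lift_x_quotient: "lift_x ((1 + fps_X) / (1 - fps_X)) = (1 + fps_X) / (1 - fps_X)"
proof -
  let ?Y = "(1 + fps_X) / (1 - fps_X :: rat fps)"
  let ?x = "fps_X :: rat fps fps fps"
  have X: "lift_x fps_X = fps_X" by (auto simp: lift_x_def fps_eq_iff)
  have "?Y * (1 - fps_X) = 1 + fps_X"
    by (simp add: fps_divide_unit mult.assoc inverse_mult_eq_1)
  from arg_cong[OF this, of lift_x] have eq: "lift_x ?Y * (1 - ?x) = 1 + ?x"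
    unfolding is_ring_homD[OF is_ring_hom_lift_x] is_ring_hom_diff[OF is_ring_hom_lift_x] X .
  have u: "(1 - ?x) $ 0 $ 0 $ 0 \<noteq> 0" by simp
  show ?thesis
    unfolding fps3_divide(2)[OF u] eq[symmetric] mult.assoc fps3_divide(1)[OF u] by simp
qed

lemma lift_x_monomial_nth:
  "(lift_x f * fps_const (fps_const fps_X) ^ i * fps_const fps_X ^ j) $ c $ b $ a =
    (if a = i \<and> b = j then f $ c else 0)"
  by (simp add: lift_x_def fps_X_power_nth)

text \<open>With Y = (1+x)/(1-x), expanding the factor that contains s gives the terms Y^(mj) s^m
  t^j for m = 2i and m = 2i + 1. So all m are covered once, and s^a t^b is met only by the summand
  (a div 2, b).\<close>

lemma fps3_sum_eq_joint_series:
  fixes s t x :: "rat fps fps fps"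
  defines "s \<equiv> fps_const (fps_const fps_X)" and "t \<equiv> fps_const fps_X" and "x \<equiv> fps_X"
  shows "fps3_sum (\<lambda>(i, j). ((1 + x) / (1 - x)) ^ (2 * i * j) *
    (1 + s * ((1 + x) / (1 - x)) ^ j) * s ^ (2 * i) * t ^ j) UNIV = Abs_fps joint_series"
proof (intro fps_ext)
  fix c b a
  let ?Y = "(1 + fps_X) / (1 - fps_X :: rat fps)"
  let ?y = "(1 + x) / (1 - x)"
  let ?f = "\<lambda>(i, j). ?y ^ (2 * i * j) * (1 + s * ?y ^ j) * s ^ (2 * i) * t ^ j"
  have y: "?y ^ k = lift_x (?Y ^ k)" for k
    unfolding is_ring_hom_power[OF is_ring_hom_lift_x] lift_x_quotient x_def ..
  have "?f (i, j) = lift_x (?Y ^ (2 * i * j)) * s ^ (2 * i) * t ^ j +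
      lift_x (?Y ^ ((2 * i + 1) * j)) * s ^ (2 * i + 1) * t ^ j" for i j
  proof -
    have e: "(2 * i + 1) * j = 2 * i * j + j" by simp
    have "?f (i, j) = ?y ^ (2 * i * j) * s ^ (2 * i) * t ^ j +
        ?y ^ (2 * i * j + j) * s ^ (2 * i + 1) * t ^ j"
      by (simp only: prod.case power_add power_one_right distrib_left distrib_right mult_1_left
          mult_1_right mult_ac)
    then show ?thesis unfolding y e .
  qed
  then have f: "?f (i, j) $ c $ b $ a =
      (if a = 2 * i \<and> b = j then ?Y ^ (2 * i * j) $ c else 0) +
      (if a = 2 * i + 1 \<and> b = j then ?Y ^ ((2 * i + 1) * j) $ c else 0)" for i j
    unfolding s_def t_def by (simp only: fps_add_nth lift_x_monomial_nth)
  have nth: "?f p $ c $ b $ a = (if p = (a div 2, b) then ?Y ^ (a * b) $ c else 0)" for p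
  proof (cases p)
    case (Pair i j)
    consider "a = 2 * i" | "a = 2 * i + 1" | "i \<noteq> a div 2" by linarith
    then show ?thesis
    proof cases
      case 3
      then have "a \<noteq> 2 * i" "a \<noteq> 2 * i + 1" by auto
      then show ?thesis using 3 unfolding Pair f by simp
    qed (unfold Pair f, auto)
  qed
  have "fps3_sum ?f UNIV $ c $ b $ a = (\<Sum>p \<in> {p \<in> UNIV. ?f p $ c $ b $ a \<noteq> 0}. ?f p $ c $ b $ a)"
    by (simp only: fps3_sum_def fps_nth_Abs_fps)
  also have "{p \<in> UNIV. ?f p $ c $ b $ a \<noteq> 0} = (if ?Y ^ (a * b) $ c = 0 then {} else {(a div 2, b)})"
    unfolding nth by auto
  also have "(\<Sum>p \<in> \<dots>. ?f p $ c $ b $ a) = ?Y ^ (a * b) $ c"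
    unfolding nth by simp
  finally show "fps3_sum ?f UNIV $ c $ b $ a = Abs_fps joint_series $ c $ b $ a"
    by (simp only: joint_series_def fps_nth_Abs_fps)
qed

lemma fps3_sum_mult_x_power:
  fixes g :: "nat \<Rightarrow> 'a::comm_ring_1 fps fps"
  shows "fps3_sum (\<lambda>n. fps_const (g n) * fps_X ^ n) {1..} = Abs_fps (\<lambda>n. if n = 0 then 0 else g n)"
proof (intro fps_ext)
  fix c b a
  have nth: "(fps_const (g n) * fps_X ^ n) $ c $ b $ a = (if n = c then g c $ b $ a else 0)" for n
    by (simp add: fps_X_power_nth)
  have "fps3_sum (\<lambda>n. fps_const (g n) * fps_X ^ n) {1..} $ c $ b $ a =
      (\<Sum>n \<in> {n \<in> {1..}. (if n = c then g c $ b $ a else 0) \<noteq> 0}. if n = c then g c $ b $ a else 0)"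
    by (simp only: fps3_sum_def fps_nth_Abs_fps nth)
  also have "{n \<in> {1..}. (if n = c then g c $ b $ a else 0) \<noteq> 0} =
      (if c = 0 \<or> g c $ b $ a = 0 then {} else {c})"
    by auto
  finally show "fps3_sum (\<lambda>n. fps_const (g n) * fps_X ^ n) {1..} $ c $ b $ a =
      Abs_fps (\<lambda>n. if n = 0 then 0 else g n) $ c $ b $ a"
    by auto
qed

text \<open>For n = 0 all coefficients are 1; this is the separate first term of (a).\<close>

lemma joint_series_0: "joint_series 0 = 1 / ((1 - fps_const fps_X) * (1 - fps_X))"
proof -
  have J: "joint_series 0 = pow_series 0 * fps_const (pow_series 0)"
    by (simp add: joint_series_def pow_series_def fps_eq_iff fps_nth_power_0 fps_divide_unit)
  have one: "pow_series 0 * (1 - fps_X) = (1 :: 'a::comm_ring_1 fps)"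
    using eulerian_A_fps_X[of 0, where 'a = 'a] by (simp add: eulerian_A_def mult.commute)
  have "fps_const (pow_series 0 * (1 - fps_X :: rat fps)) = fps_const 1"
    unfolding one ..
  then have "fps_const (pow_series 0) * (1 - fps_const fps_X) = (1 :: rat fps fps)"
    unfolding fps_const_hom .
  moreover have "joint_series 0 * ((1 - fps_const fps_X) * (1 - fps_X)) =
      (fps_const (pow_series 0) * (1 - fps_const fps_X)) * (pow_series 0 * (1 - fps_X))"
    unfolding J by (simp only: mult_ac)
  ultimately have "joint_series 0 * ((1 - fps_const fps_X) * (1 - fps_X)) = 1"
    by (simp only: one mult_1_right)
  then show ?thesis by (rule fps2_divide_eqI[symmetric, rotated]) simp
qed

text \<open>Everything except x^n lies in the image of \<open>fps_const\<close>, so the coefficients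
  in x reduce to the identities in two variables.\<close>

lemma joint_series_generating_function:
  fixes s t x :: "rat fps fps fps"
  defines "s \<equiv> fps_const (fps_const fps_X)" and "t \<equiv> fps_const fps_X" and "x \<equiv> fps_X"
  shows "1 / ((1 - s) * (1 - t)) + 1 / (4 * (1 - s)\<^sup>2) *
      fps3_sum (\<lambda>n. (1 + s\<^sup>2) ^ n / (1 - s\<^sup>2) ^ (n - 1) * ((1 + t) / (1 - t)) ^ (n + 1) *
        P_udr_ipk n (2 * s / (1 + s\<^sup>2)) (4 * t / (1 + t)\<^sup>2) * x ^ n) {1..} = Abs_fps joint_series"
proof -
  define s' t' :: "rat fps fps" where "s' = fps_const fps_X" and "t' = fps_X"
  define g where "g n = (1 + s'\<^sup>2) ^ n / (1 - s'\<^sup>2) ^ (n - 1) * ((1 + t') / (1 - t')) ^ (n + 1) *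
    P_udr_ipk n (2 * s' / (1 + s'\<^sup>2)) (4 * t' / (1 + t')\<^sup>2)" for n
  have st: "s = fps_const s'" "t = fps_const t'" by (simp_all add: s_def t_def s'_def t'_def)
  have unit: "(1 + s'\<^sup>2) $ 0 $ 0 \<noteq> 0" "((1 + t')\<^sup>2) $ 0 $ 0 \<noteq> 0" "(1 - t') $ 0 $ 0 \<noteq> 0"
      "((1 - s'\<^sup>2) ^ k) $ 0 $ 0 \<noteq> 0" "(4 * (1 - s')\<^sup>2) $ 0 $ 0 \<noteq> 0"
      "((1 - s') * (1 - t')) $ 0 $ 0 \<noteq> 0" for k
    by (simp_all add: s'_def t'_def fps_nth_power_0 numeral_fps_const)
  have g: "(1 + s\<^sup>2) ^ n / (1 - s\<^sup>2) ^ (n - 1) * ((1 + t) / (1 - t)) ^ (n + 1) *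
      P_udr_ipk n (2 * s / (1 + s\<^sup>2)) (4 * t / (1 + t)\<^sup>2) = fps_const (g n)" for n
    unfolding st g_def fps_const_divide[OF unit(1), symmetric] fps_const_divide[OF unit(2), symmetric]
      fps_const_divide[OF unit(3), symmetric] fps_const_divide[OF unit(4), symmetric] fps_const_hom
      is_ring_hom_P_udr_ipk[OF is_ring_hom_fps_const] ..
  have a: "1 / (4 * (1 - s)\<^sup>2) = fps_const (1 / (4 * (1 - s')\<^sup>2))"
    unfolding st fps_const_divide[OF unit(5), symmetric] fps_const_hom ..
  have b: "1 / ((1 - s) * (1 - t)) = fps_const (1 / ((1 - s') * (1 - t')))"
    unfolding st fps_const_divide[OF unit(6), symmetric] fps_const_hom ..
  have J0: "1 / ((1 - s') * (1 - t')) = joint_series 0"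
    unfolding s'_def t'_def by (rule joint_series_0[symmetric])
  have Jn: "1 / (4 * (1 - s')\<^sup>2) * g n = joint_series n" if "n \<noteq> 0" for n
    using P_udr_ipk_eq_joint_series[of n] that unfolding g_def s'_def t'_def
    by (simp only: mult.assoc One_nat_def Suc_le_eq neq0_conv)
  show ?thesis
  proof (rule fps_ext)
    fix n
    show "(1 / ((1 - s) * (1 - t)) + 1 / (4 * (1 - s)\<^sup>2) *
        fps3_sum (\<lambda>n. (1 + s\<^sup>2) ^ n / (1 - s\<^sup>2) ^ (n - 1) * ((1 + t) / (1 - t)) ^ (n + 1) *
          P_udr_ipk n (2 * s / (1 + s\<^sup>2)) (4 * t / (1 + t)\<^sup>2) * x ^ n) {1..}) $ n =
        Abs_fps joint_series $ n"
      unfolding g a b J0 x_def fps3_sum_mult_x_power fps_add_nth fps_mult_left_const_nth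
        fps_nth_Abs_fps fps_nth_fps_const
      using Jn[of n] by (cases "n = 0") (simp_all only: if_True if_False simp_thms mult_zero_right
          add_0_left add_0_right)
  qed
qed

theorem theorem5p3:
  shows
    "(let s = fps_const (fps_const fps_X) :: rat fps fps fps;
          t = fps_const fps_X :: rat fps fps fps;
          x = fps_X :: rat fps fps fps
      in 1 / ((1 - s) * (1 - t)) +
           1 / (4 * (1 - s)\<^sup>2) *
             fps3_sum (\<lambda>n. (1 + s\<^sup>2) ^ n / (1 - s\<^sup>2) ^ (n - 1) * ((1 + t) / (1 - t)) ^ (n + 1) *
               P_udr_ipk n (2 * s / (1 + s\<^sup>2)) (4 * t / (1 + t)\<^sup>2) * x ^ n) {1..}
         = fps3_sum (\<lambda>(i, j). ((1 + x) / (1 - x)) ^ (2 * i * j) *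
               (1 + s * ((1 + x) / (1 - x)) ^ j) * s ^ (2 * i) * t ^ j) UNIV)
     \<and>
     (\<forall>n \<ge> 1.
      let s = fps_const fps_X :: rat fps fps;
          t = fps_X :: rat fps fps
      in 1 / (4 * (1 - s)\<^sup>2) * ((1 + s\<^sup>2) ^ n / (1 - s\<^sup>2) ^ (n - 1)) *
           ((1 + t) / (1 - t)) ^ (n + 1) *
           P_udr_ipk n (2 * s / (1 + s\<^sup>2)) (4 * t / (1 + t)\<^sup>2)
         = 1 / of_nat (fact n) *
             (\<Sum>k = 0..n. 2 ^ k * of_nat (odd_cycles_perms n k) *
               (((2 ^ k * eulerian_A k (s\<^sup>2) + s * eulerian_B k (s\<^sup>2)) * eulerian_A k t) /
                 ((1 - s\<^sup>2) ^ (k + 1) * (1 - t) ^ (k + 1)))))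
     \<and>
     (\<forall>n \<ge> 1.
      let s = [:[:0, 1:]:] :: rat poly poly;
          t = [:0, 1:] :: rat poly poly
      in P_udr_ipk n s t
         = smult [:1 / fact n:]
             (\<Sum>k = 0..n. of_nat (odd_cycles_perms n k) *
               ((1 - s\<^sup>2) * (1 - t)) ^ ((n - k) div 2) * P_udr k s * P_pk k t))"
  unfolding Let_def
proof (intro conjI allI impI, goal_cases)
  case 1
  show ?case
    unfolding joint_series_generating_function fps3_sum_eq_joint_series ..
next
  case (2 n)
  show ?case
    unfolding P_udr_ipk_eq_joint_series[OF 2] by (rule joint_series_eulerian)
next
  case (3 n)
  then show ?case by (rule P_udr_ipk_poly_identity)
qed

end
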